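(* Let $r,R>0$. Let $\varphi\in L^2(\mathbb{R}^2,\mathbb{H})\cap L^{\infty}(\mathbb{R}^2,\mathbb{H})$ be a nonzero window function such that $\operatorname{supp}\varphi\subseteq B_r$, and let $\Sigma=S\times B_R\subset\mathbb{R}^2\times\mathbb{R}^2$, where $S\subset\mathbb{R}^2$ is measurable, be a subset of finite measure $0<m(\Sigma)<\infty$ (points of $\Sigma$ are written $(\omega,b)$ with $\omega\in S$, $b\in B_R$). Then $$\operatorname{Im}P_{\varphi}\cap\operatorname{Im}P_{\Sigma}=\{0\},$$ i.e., $\Sigma$ is weakly annihilating (with respect to the window $\varphi$).
   Context: $\mathbb{H}$ is the algebra of real quaternions with imaginary units $i,j,k$ ($i^2=j^2=k^2=ijk=-1$), conjugation $\overline{q}$ and modulus $|q|=\sqrt{q\overline{q}}$. $L^p(\mathbb{R}^n,\mathbb{H})$ is the usual Lebesgue space of $\mathbb{H}$-valued measurable functions, and $m$ is Lebesgue measure on $\mathbb{R}^2\times\mathbb{R}^2$. For $\rho>0$, $B_\rho$ is the open ball of centre $0$ and radius $\rho$ in $\mathbb{R}^2$. For $f,\varphi\in L^2(\mathbb{R}^2,\mathbb{H})$ with $\varphi\neq 0$ (the window), the two-sided Gabor quaternion Fourier transform (GQFT) of $f$ is $$\mathcal{G}_{\varphi}\{f\}(\omega,b)=\int_{\mathbb{R}^2}e^{-2\pi i x_1\omega_1}\,f(x)\,\overline{\varphi(x-b)}\,e^{-2\pi j x_2\omega_2}\,dx,\qquad \omega=(\omega_1,\omega_2),\ b\in\mathbb{R}^2.$$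 It satisfies $\int_{\mathbb{R}^2}\int_{\mathbb{R}^2}|\mathcal{G}_{\varphi}\{f\}(\omega,b)|^2\,d\omega\,db=\|f\|_2^2\|\varphi\|_2^2$ (Plancherel formula), so the range $\mathcal{G}_\varphi(L^2(\mathbb{R}^2,\mathbb{H}))$ is a closed real-linear subspace of $L^2(\mathbb{R}^2\times\mathbb{R}^2,\mathbb{H})$. $P_\varphi$ denotes the orthogonal projection of $L^2(\mathbb{R}^2\times\mathbb{R}^2,\mathbb{H})$ (as a real Hilbert space with inner product $\mathrm{Re}\int\int F\,\overline{G}$) onto the range $\mathcal{G}_\varphi(L^2(\mathbb{R}^2,\mathbb{H}))$. $P_\Sigma$ denotes the orthogonal projection $P_\Sigma F=\chi_\Sigma F$, where $\chi_\Sigma$ is the indicator function of $\Sigma$. $\operatorname{Im}$ denotes the range of an operator. A measurable set $\Sigma\subset\mathbb{R}^2\times\mathbb{R}^2$ is weakly annihilating (with respect to $\varphi$) if every $f\in L^2(\mathbb{R}^2,\mathbb{H})$ whose transform $\mathcal{G}_\varphi\{f\}$ is supported in $\Sigma$ (vanishes almost everywhere outside $\Sigma$) satisfies $f=0$. *)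

theory Defs
  imports "HOL-Analysis.Analysis"
begin

section \<open>Quaternions\<close>

datatype quat = Quat (qre: real) (qi: real) (qj: real) (qk: real)

lemma quat_eq_iff: "x = y \<longleftrightarrow> qre x = qre y \<and> qi x = qi y \<and> qj x = qj y \<and> qk x = qk y"
  by (auto intro: quat.expand)

instantiation quat :: ring_1
begin

definition "0 = Quat 0 0 0 0"
definition "1 = Quat 1 0 0 0"
definition "x + y = Quat (qre x + qre y) (qi x + qi y) (qj x + qj y) (qk x + qk y)"
definition "- x = Quat (- qre x) (- qi x) (- qj x) (- qk x)"
definition "x - y = Quat (qre x - qre y) (qi x - qi y) (qj x - qj y) (qk x - qk y)"
definition "x * y = Quat
  (qre x * qre y - qi x * qi y - qj x * qj y - qk x * qk y)
  (qre x * qi y + qi x * qre y + qj x * qk y - qk x * qj y)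
  (qre x * qj y - qi x * qk y + qj x * qre y + qk x * qi y)
  (qre x * qk y + qi x * qj y - qj x * qi y + qk x * qre y)"

instance
  by standard
    (simp_all add: zero_quat_def one_quat_def plus_quat_def uminus_quat_def minus_quat_def
      times_quat_def quat_eq_iff algebra_simps)

end

lemma quat_zero_sel [simp]: "qre 0 = 0" "qi 0 = 0" "qj 0 = 0" "qk 0 = 0"
  by (simp_all add: zero_quat_def)

lemma quat_one_sel [simp]: "qre 1 = 1" "qi 1 = 0" "qj 1 = 0" "qk 1 = 0"
  by (simp_all add: one_quat_def)

lemma quat_add_sel [simp]:
  "qre (x + y) = qre x + qre y" "qi (x + y) = qi x + qi y"
  "qj (x + y) = qj x + qj y" "qk (x + y) = qk x + qk y"
  by (simp_all add: plus_quat_def)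

lemma quat_uminus_sel [simp]:
  "qre (- x) = - qre x" "qi (- x) = - qi x" "qj (- x) = - qj x" "qk (- x) = - qk x"
  by (simp_all add: uminus_quat_def)

lemma quat_diff_sel [simp]:
  "qre (x - y) = qre x - qre y" "qi (x - y) = qi x - qi y"
  "qj (x - y) = qj x - qj y" "qk (x - y) = qk x - qk y"
  by (simp_all add: minus_quat_def)

lemma quat_mult_sel:
  "qre (x * y) = qre x * qre y - qi x * qi y - qj x * qj y - qk x * qk y"
  "qi (x * y) = qre x * qi y + qi x * qre y + qj x * qk y - qk x * qj y"
  "qj (x * y) = qre x * qj y - qi x * qk y + qj x * qre y + qk x * qi y"
  "qk (x * y) = qre x * qk y + qi x * qj y - qj x * qi y + qk x * qre y"
  by (simp_all add: times_quat_def)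

instantiation quat :: real_algebra_1
begin

definition "r *\<^sub>R x = Quat (r * qre x) (r * qi x) (r * qj x) (r * qk x)"

instance
  by standard
    (simp_all add: scaleR_quat_def quat_eq_iff quat_mult_sel algebra_simps)

end

lemma quat_scaleR_sel [simp]:
  "qre (r *\<^sub>R x) = r * qre x" "qi (r *\<^sub>R x) = r * qi x"
  "qj (r *\<^sub>R x) = r * qj x" "qk (r *\<^sub>R x) = r * qk x"
  by (simp_all add: scaleR_quat_def)

instantiation quat :: euclidean_space
begin

definition inner_quat :: "quat \<Rightarrow> quat \<Rightarrow> real" where
  "inner_quat x y = qre x * qre y + qi x * qi y + qj x * qj y + qk x * qk y"

definition norm_quat :: "quat \<Rightarrow> real" where
  "norm_quat x = sqrt (inner x x)"

definition dist_quat :: "quat \<Rightarrow> quat \<Rightarrow> real" where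
  "dist_quat x y = norm (x - y)"

definition sgn_quat :: "quat \<Rightarrow> quat" where
  "sgn_quat x = x /\<^sub>R norm x"

definition uniformity_quat :: "(quat \<times> quat) filter" where
  "uniformity_quat = (INF e\<in>{0 <..}. principal {(x, y). dist x y < e})"

definition open_quat :: "quat set \<Rightarrow> bool" where
  "open_quat U \<longleftrightarrow> (\<forall>x\<in>U. eventually (\<lambda>(x', y). x' = x \<longrightarrow> y \<in> U) uniformity)"

definition Basis_quat :: "quat set" where
  "Basis_quat = {Quat 1 0 0 0, Quat 0 1 0 0, Quat 0 0 1 0, Quat 0 0 0 1}"

instance
proof
  fix x y z :: quat and r :: real
  show "0 \<le> inner x x"
    by (simp add: inner_quat_def)
  show "inner x x = 0 \<longleftrightarrow> x = 0"
    by (auto simp: inner_quat_def quat_eq_iff add_nonneg_eq_0_iff)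
  show "(\<forall>u\<in>Basis. inner x u = 0) \<longleftrightarrow> x = 0"
    by (simp add: inner_quat_def Basis_quat_def quat_eq_iff[of x 0])
qed (auto simp: dist_quat_def sgn_quat_def uniformity_quat_def open_quat_def norm_quat_def
      inner_quat_def Basis_quat_def quat_eq_iff algebra_simps)

end

instance quat :: real_normed_algebra_1
proof
  fix x y :: quat
  have "(norm (x * y))\<^sup>2 = (norm x * norm y)\<^sup>2"
    by (simp add: norm_quat_def inner_quat_def quat_mult_sel power_mult_distrib)
      (simp add: algebra_simps power2_eq_square)
  then show "norm (x * y) \<le> norm x * norm y"
    by (simp add: norm_quat_def)
  show "norm (1 :: quat) = 1"
    by (simp add: norm_quat_def inner_quat_def)
qed

definition qcnj :: "quat \<Rightarrow> quat" where
  "qcnj x = Quat (qre x) (- qi x) (- qj x) (- qk x)"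

definition quat_i :: quat where "quat_i = Quat 0 1 0 0"
definition quat_j :: quat where "quat_j = Quat 0 0 1 0"
definition quat_k :: quat where "quat_k = Quat 0 0 0 1"

lemma quat_units:
  "quat_i * quat_i = - 1" "quat_j * quat_j = - 1" "quat_k * quat_k = - 1"
  "quat_i * quat_j * quat_k = - 1"
  by (simp_all add: quat_i_def quat_j_def quat_k_def quat_eq_iff quat_mult_sel)

lemma mult_qcnj: "x * qcnj x = of_real ((norm x)\<^sup>2)"
  by (simp add: of_real_def norm_quat_def inner_quat_def qcnj_def quat_eq_iff quat_mult_sel)

lemma inner_quat_eq: "inner x y = qre (x * qcnj y)"
  by (simp add: inner_quat_def qcnj_def quat_mult_sel)


section \<open>The real Hilbert space of square-integrable functions\<close>

definition square_integrable :: "('a::euclidean_space \<Rightarrow> 'b::euclidean_space) \<Rightarrow> bool" where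
  "square_integrable f \<longleftrightarrow>
     f \<in> borel_measurable lebesgue \<and> integrable lebesgue (\<lambda>x. (norm (f x))\<^sup>2)"

lemma square_integrable_zero [simp]: "square_integrable (\<lambda>x. 0)"
  by (simp add: square_integrable_def)

lemma square_integrable_add:
  assumes "square_integrable f" "square_integrable g"
  shows "square_integrable (\<lambda>x. f x + g x)"
proof -
  have [measurable]: "f \<in> borel_measurable lebesgue" "g \<in> borel_measurable lebesgue"
    using assms by (auto simp: square_integrable_def)
  have "integrable lebesgue (\<lambda>x. 2 * (norm (f x))\<^sup>2 + 2 * (norm (g x))\<^sup>2)"
    using assms by (auto simp: square_integrable_def)
  then have "integrable lebesgue (\<lambda>x. (norm (f x + g x))\<^sup>2)"
  proof (rule Bochner_Integration.integrable_bound)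
    show "AE x in lebesgue. norm ((norm (f x + g x))\<^sup>2)
        \<le> norm (2 * (norm (f x))\<^sup>2 + 2 * (norm (g x))\<^sup>2)"
    proof (rule AE_I2)
      fix x
      have "(norm (f x + g x))\<^sup>2 \<le> (norm (f x) + norm (g x))\<^sup>2"
        by (intro power_mono norm_triangle_ineq norm_ge_zero)
      also have "\<dots> \<le> 2 * (norm (f x))\<^sup>2 + 2 * (norm (g x))\<^sup>2"
        using sum_squares_bound[of "norm (f x)" "norm (g x)"] by (simp add: power2_sum)
      finally show "norm ((norm (f x + g x))\<^sup>2) \<le> norm (2 * (norm (f x))\<^sup>2 + 2 * (norm (g x))\<^sup>2)"
        by simp
    qed
  qed measurable
  then show ?thesis
    by (simp add: square_integrable_def)
qed

lemma square_integrable_scaleR: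
  "square_integrable f \<Longrightarrow> square_integrable (\<lambda>x. r *\<^sub>R f x)"
  by (auto simp: square_integrable_def power_mult_distrib)

lemma square_integrable_uminus:
  "square_integrable f \<Longrightarrow> square_integrable (\<lambda>x. - f x)"
  using square_integrable_scaleR[of f "- 1"] by simp

lemma square_integrable_diff:
  "square_integrable f \<Longrightarrow> square_integrable g \<Longrightarrow> square_integrable (\<lambda>x. f x - g x)"
  using square_integrable_add[of f "\<lambda>x. - g x"] square_integrable_uminus[of g] by simp

lemma integrable_inner_square_integrable:
  assumes "square_integrable f" "square_integrable g"
  shows "integrable lebesgue (\<lambda>x. inner (f x) (g x))"
proof -
  have [measurable]: "f \<in> borel_measurable lebesgue" "g \<in> borel_measurable lebesgue"
    using assms by (auto simp: square_integrable_def)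
  have "integrable lebesgue (\<lambda>x. (norm (f x))\<^sup>2 + (norm (g x))\<^sup>2)"
    using assms by (auto simp: square_integrable_def)
  then show ?thesis
  proof (rule Bochner_Integration.integrable_bound)
    show "AE x in lebesgue. norm (inner (f x) (g x)) \<le> norm ((norm (f x))\<^sup>2 + (norm (g x))\<^sup>2)"
    proof (rule AE_I2)
      fix x
      have "\<bar>inner (f x) (g x)\<bar> \<le> norm (f x) * norm (g x)"
        by (rule Cauchy_Schwarz_ineq2)
      moreover have "2 * norm (f x) * norm (g x) \<le> (norm (f x))\<^sup>2 + (norm (g x))\<^sup>2"
        by (rule sum_squares_bound)
      moreover have "0 \<le> norm (f x) * norm (g x)"
        by simp
      ultimately show "norm (inner (f x) (g x)) \<le> norm ((norm (f x))\<^sup>2 + (norm (g x))\<^sup>2)"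
        by simp
    qed
  qed measurable
qed

definition L2_rel :: "('a::euclidean_space \<Rightarrow> 'b::euclidean_space) \<Rightarrow> ('a \<Rightarrow> 'b) \<Rightarrow> bool" where
  "L2_rel f g \<longleftrightarrow> square_integrable f \<and> square_integrable g \<and> (AE x in lebesgue. f x = g x)"

quotient_type (overloaded) ('a, 'b) L2 = "'a::euclidean_space \<Rightarrow> 'b::euclidean_space" / partial: L2_rel
  morphisms L2_fun L2_class
proof (rule part_equivpI)
  show "\<exists>f::'a \<Rightarrow> 'b. L2_rel f f"
    by (rule exI[of _ "\<lambda>x. 0"]) (simp add: L2_rel_def)
  show "symp (L2_rel :: ('a \<Rightarrow> 'b) \<Rightarrow> _)"
    by (auto simp: symp_def L2_rel_def eq_commute)
  show "transp (L2_rel :: ('a \<Rightarrow> 'b) \<Rightarrow> _)"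
    unfolding transp_def L2_rel_def by auto
qed

lemma L2_rel_L2_fun: "L2_rel (L2_fun F) (L2_fun F)"
  by (rule Quotient3_rep_reflp[OF Quotient3_L2])

lemma square_integrable_L2_fun: "square_integrable (L2_fun F)"
  using L2_rel_L2_fun[of F] by (simp add: L2_rel_def)

lemma L2_class_L2_fun: "L2_class (L2_fun F) = F"
  by (rule Quotient3_abs_rep[OF Quotient3_L2])

lemma L2_eq_iff: "F = G \<longleftrightarrow> (AE x in lebesgue. L2_fun F x = L2_fun G x)"
  using Quotient3_rel_rep[OF Quotient3_L2, of F G] square_integrable_L2_fun
  by (auto simp: L2_rel_def)

lemma L2_fun_L2_class:
  "square_integrable f \<Longrightarrow> AE x in lebesgue. L2_fun (L2_class f) x = f x"
  using Quotient3_rep_abs[OF Quotient3_L2, of f] by (auto simp: L2_rel_def)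

instantiation L2 :: (euclidean_space, euclidean_space) real_vector
begin

lift_definition zero_L2 :: "('a, 'b) L2" is "\<lambda>x. 0"
  by (simp add: L2_rel_def)

lift_definition plus_L2 :: "('a, 'b) L2 \<Rightarrow> ('a, 'b) L2 \<Rightarrow> ('a, 'b) L2"
  is "\<lambda>f g x. f x + g x"
  by (auto simp: L2_rel_def intro!: square_integrable_add)

lift_definition scaleR_L2 :: "real \<Rightarrow> ('a, 'b) L2 \<Rightarrow> ('a, 'b) L2"
  is "\<lambda>r f x. r *\<^sub>R f x"
  by (auto simp: L2_rel_def intro!: square_integrable_scaleR)

lift_definition uminus_L2 :: "('a, 'b) L2 \<Rightarrow> ('a, 'b) L2" is "\<lambda>f x. - f x"
  by (auto simp: L2_rel_def intro!: square_integrable_uminus)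

lift_definition minus_L2 :: "('a, 'b) L2 \<Rightarrow> ('a, 'b) L2 \<Rightarrow> ('a, 'b) L2"
  is "\<lambda>f g x. f x - g x"
  by (auto simp: L2_rel_def intro!: square_integrable_diff)

instance
proof
  fix F G H :: "('a, 'b) L2" and r s :: real
  show "F + G + H = F + (G + H)"
    by transfer (auto simp: L2_rel_def add.assoc intro!: square_integrable_add)
  show "F + G = G + F"
    by transfer (auto simp: L2_rel_def add.commute intro!: square_integrable_add)
  show "0 + F = F"
    by transfer (auto simp: L2_rel_def)
  show "- F + F = 0"
    by transfer (simp add: L2_rel_def)
  show "F - G = F + - G"
    by transfer (simp add: L2_rel_def square_integrable_diff)
  show "r *\<^sub>R (F + G) = r *\<^sub>R F + r *\<^sub>R G"
    by transfer (auto simp: L2_rel_def scaleR_add_right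
        intro!: square_integrable_add square_integrable_scaleR)
  show "(r + s) *\<^sub>R F = r *\<^sub>R F + s *\<^sub>R F"
    by transfer (auto simp: L2_rel_def scaleR_add_left
        intro!: square_integrable_add square_integrable_scaleR)
  show "r *\<^sub>R s *\<^sub>R F = (r * s) *\<^sub>R F"
    by transfer (auto simp: L2_rel_def intro!: square_integrable_scaleR)
  show "1 *\<^sub>R F = F"
    by transfer (auto simp: L2_rel_def)
qed

end

instantiation L2 :: (euclidean_space, euclidean_space) real_inner
begin

lift_definition inner_L2 :: "('a, 'b) L2 \<Rightarrow> ('a, 'b) L2 \<Rightarrow> real"
  is "\<lambda>f g. LINT x|lebesgue. inner (f x) (g x)"
proof -
  fix f f' g g' :: "'a \<Rightarrow> 'b"
  assume *: "L2_rel f f'" "L2_rel g g'"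
  then have [measurable]: "f \<in> borel_measurable lebesgue" "f' \<in> borel_measurable lebesgue"
    "g \<in> borel_measurable lebesgue" "g' \<in> borel_measurable lebesgue"
    by (auto simp: L2_rel_def square_integrable_def)
  have "AE x in lebesgue. f x = f' x" "AE x in lebesgue. g x = g' x"
    using * by (auto simp: L2_rel_def)
  then have "AE x in lebesgue. inner (f x) (g x) = inner (f' x) (g' x)"
    by eventually_elim simp
  then show "(LINT x|lebesgue. inner (f x) (g x)) = (LINT x|lebesgue. inner (f' x) (g' x))"
    by (intro integral_cong_AE) measurable
qed

definition norm_L2 :: "('a, 'b) L2 \<Rightarrow> real" where
  "norm_L2 F = sqrt (inner F F)"

definition dist_L2 :: "('a, 'b) L2 \<Rightarrow> ('a, 'b) L2 \<Rightarrow> real" where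
  "dist_L2 F G = norm (F - G)"

definition sgn_L2 :: "('a, 'b) L2 \<Rightarrow> ('a, 'b) L2" where
  "sgn_L2 F = F /\<^sub>R norm F"

definition uniformity_L2 :: "(('a, 'b) L2 \<times> ('a, 'b) L2) filter" where
  "uniformity_L2 = (INF e\<in>{0 <..}. principal {(F, G). dist F G < e})"

definition open_L2 :: "('a, 'b) L2 set \<Rightarrow> bool" where
  "open_L2 U \<longleftrightarrow> (\<forall>F\<in>U. eventually (\<lambda>(F', G). F' = F \<longrightarrow> G \<in> U) uniformity)"

instance
proof
  fix F G H :: "('a, 'b) L2" and r :: real
  show "sgn F = F /\<^sub>R norm F"
    by (simp add: sgn_L2_def)
  show "dist F G = norm (F - G)"
    by (simp add: dist_L2_def)
  show "(uniformity :: (('a, 'b) L2 \<times> ('a, 'b) L2) filter) =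
      (INF e\<in>{0 <..}. principal {(F, G). dist F G < e})"
    by (simp add: uniformity_L2_def)
  show "open U \<longleftrightarrow> (\<forall>F\<in>U. eventually (\<lambda>(F', G). F' = F \<longrightarrow> G \<in> U) uniformity)"
    for U :: "('a, 'b) L2 set"
    by (simp add: open_L2_def)
  show "inner F G = inner G F"
    by transfer (simp add: inner_commute)
  show "inner (F + G) H = inner F H + inner G H"
    by transfer (simp add: L2_rel_def inner_add_left integrable_inner_square_integrable)
  show "inner (r *\<^sub>R F) G = r * inner F G"
    by transfer simp
  show "0 \<le> inner F F"
    by transfer (simp add: integral_nonneg_AE)
  show "inner F F = 0 \<longleftrightarrow> F = 0"
  proof transfer
    fix f :: "'a \<Rightarrow> 'b"
    assume "L2_rel f f"
    then have f: "square_integrable f"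
      by (simp add: L2_rel_def)
    have "(LINT x|lebesgue. inner (f x) (f x)) = 0 \<longleftrightarrow> (AE x in lebesgue. inner (f x) (f x) = 0)"
      by (rule integral_nonneg_eq_0_iff_AE)
        (use integrable_inner_square_integrable[OF f f] in auto)
    with f show "(LINT x|lebesgue. inner (f x) (f x)) = 0 \<longleftrightarrow> L2_rel f (\<lambda>x. 0)"
      by (simp add: L2_rel_def)
  qed
  show "norm F = sqrt (inner F F)"
    by (simp add: norm_L2_def)
qed

end

lemma inner_L2_quat:
  "inner F G = (LINT x|lebesgue. qre (L2_fun F x * qcnj (L2_fun G x)))"
  for F G :: "('a::euclidean_space, quat) L2"
  by (simp add: inner_L2.rep_eq inner_quat_eq)

definition essentially_bounded :: "('a::euclidean_space, 'b::euclidean_space) L2 \<Rightarrow> bool" where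
  "essentially_bounded F \<longleftrightarrow> (\<exists>C. AE x in lebesgue. norm (L2_fun F x) \<le> C)"

definition ess_supp :: "('a::euclidean_space, 'b::euclidean_space) L2 \<Rightarrow> 'a set" where
  "ess_supp F = - \<Union>{U. open U \<and> (AE x in lebesgue. x \<in> U \<longrightarrow> L2_fun F x = 0)}"


section \<open>Orthogonal projections\<close>

text \<open>On a subspace \<open>V\<close> the vector \<open>y\<close> is unique if it exists, and it exists for all \<open>x\<close> when
  \<open>V\<close> is a complete subspace. The value \<open>0\<close> is only a convention making the function total.\<close>

definition orth_projection :: "'a::real_inner set \<Rightarrow> 'a \<Rightarrow> 'a" where
  "orth_projection V x =
     (if \<exists>!y. y \<in> V \<and> x - y \<in> V\<^sup>\<bottom> then THE y. y \<in> V \<and> x - y \<in> V\<^sup>\<bottom> else 0)"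

definition P_set :: "'a::euclidean_space set \<Rightarrow> ('a, 'b::euclidean_space) L2 \<Rightarrow> ('a, 'b) L2" where
  "P_set \<Sigma> F = L2_class (\<lambda>z. indicator \<Sigma> z *\<^sub>R L2_fun F z)"

lemma L2_fun_P_set:
  assumes [measurable]: "\<Sigma> \<in> sets lebesgue"
  shows "AE z in lebesgue. L2_fun (P_set \<Sigma> F) z = indicator \<Sigma> z *\<^sub>R L2_fun F z"
proof -
  have [measurable]: "L2_fun F \<in> borel_measurable lebesgue"
    and int: "integrable lebesgue (\<lambda>z. (norm (L2_fun F z))\<^sup>2)"
    using square_integrable_L2_fun[of F] by (auto simp: square_integrable_def)
  have "integrable lebesgue (\<lambda>z. (norm (indicator \<Sigma> z *\<^sub>R L2_fun F z))\<^sup>2)"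
    by (rule Bochner_Integration.integrable_bound[OF int])
      (measurable, auto simp: indicator_def)
  then show ?thesis
    unfolding P_set_def by (intro L2_fun_L2_class) (simp add: square_integrable_def)
qed


section \<open>The two-sided Gabor quaternion Fourier transform\<close>

definition gqft ::
  "(real^2, quat) L2 \<Rightarrow> (real^2, quat) L2 \<Rightarrow> (real^2) \<times> (real^2) \<Rightarrow> quat" where
  "gqft \<phi> f = (\<lambda>(\<omega>, b). LINT x|lebesgue.
      exp ((- 2 * pi * (x $ 1) * (\<omega> $ 1)) *\<^sub>R quat_i) * L2_fun f x * qcnj (L2_fun \<phi> (x - b))
        * exp ((- 2 * pi * (x $ 2) * (\<omega> $ 2)) *\<^sub>R quat_j))"

text \<open>By the Plancherel formula every \<open>gqft \<phi> f\<close> is square integrable, so every \<open>f\<close> contributes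
  an element to the following set.\<close>

definition gqft_range :: "(real^2, quat) L2 \<Rightarrow> ((real^2) \<times> (real^2), quat) L2 set" where
  "gqft_range \<phi> = {F. \<exists>f. AE z in lebesgue. L2_fun F z = gqft \<phi> f z}"

definition P_window ::
  "(real^2, quat) L2 \<Rightarrow> ((real^2) \<times> (real^2), quat) L2 \<Rightarrow> ((real^2) \<times> (real^2), quat) L2" where
  "P_window \<phi> = orth_projection (gqft_range \<phi>)"

definition weakly_annihilating :: "(real^2, quat) L2 \<Rightarrow> ((real^2) \<times> (real^2)) set \<Rightarrow> bool" where
  "weakly_annihilating \<phi> \<Sigma> \<longleftrightarrow> \<Sigma> \<in> sets lebesgue \<and>
     (\<forall>f. (AE z in lebesgue. z \<notin> \<Sigma> \<longrightarrow> gqft \<phi> f z = 0) \<longrightarrow> f = 0)"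

end

theory Submission
  imports Defs "HOL-Complex_Analysis.Conformal_Mappings"
begin

text \<open>For fixed \<open>b\<close>, the transform \<open>\<omega> \<mapsto> gqft \<phi> f (\<omega>, b)\<close> is the two-sided quaternion Fourier transform
  of \<open>g b x = f x * qcnj (\<phi> (x - b))\<close>, which is integrable and has bounded support because \<open>\<phi>\<close> does.
  Hence it is real analytic along the coordinate lines. If \<open>gqft \<phi> f\<close> vanishes outside \<open>\<Sigma>\<close>, then for
  almost every \<open>b\<close> it vanishes on the complement of \<open>S\<close>, which is not a null set since \<open>S\<close> has finite
  measure. So it vanishes identically, and injectivity of the transform gives
  \<open>f x * qcnj (\<phi> (x - b)) = 0\<close> for almost all \<open>x\<close> and \<open>b\<close>, which forces \<open>f = 0\<close> as \<open>\<phi> \<noteq> 0\<close>.\<close>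

section \<open>Zeros of analytic integrals\<close>

text \<open>The exponential is expanded and integrated term by term. The bound \<open>C\<close>
  dominates the n-th term by \<open>norm (w x) * (norm z * C) ^ n / fact n\<close>, so the resulting
  power series converges everywhere.\<close>

lemma holomorphic_integral_exp:
  fixes w c :: "'a \<Rightarrow> complex"
  assumes w: "integrable M w" and [measurable]: "c \<in> borel_measurable M"
    and C: "\<And>x. norm (c x) \<le> C"
  shows "(\<lambda>z. LINT x|M. w x * exp (z * c x)) holomorphic_on UNIV"
proof -
  have [measurable]: "w \<in> borel_measurable M"
    using w by (rule borel_measurable_integrable)
  have intw: "integrable M (\<lambda>x. w x * (c x ^ n /\<^sub>R fact n))" for n
  proof (rule Bochner_Integration.integrable_bound)
    show "integrable M (\<lambda>x. C ^ n * norm (w x) / fact n)"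
      using w by auto
    show "AE x in M. norm (w x * (c x ^ n /\<^sub>R fact n)) \<le> norm (C ^ n * norm (w x) / fact n)"
    proof (rule AE_I2)
      fix x
      have "norm (c x) ^ n \<le> \<bar>C ^ n\<bar>"
        using power_mono[OF C[of x], of n] by simp
      then have "norm (w x) * norm (c x) ^ n \<le> norm (w x) * \<bar>C ^ n\<bar>"
        by (intro mult_left_mono) auto
      then show "norm (w x * (c x ^ n /\<^sub>R fact n)) \<le> norm (C ^ n * norm (w x) / fact n)"
        by (simp add: norm_mult norm_power abs_mult field_simps)
    qed
  qed measurable
  have sums: "(\<lambda>n. (LINT x|M. w x * (c x ^ n /\<^sub>R fact n)) * (z - 0) ^ n) sums (LINT x|M. w x * exp (z * c x))" for z
  proof -
    let ?f = "\<lambda>n x. w x * (c x ^ n /\<^sub>R fact n) * z ^ n"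
    have bd: "norm (?f n x) \<le> norm (w x) * ((norm z * C) ^ n /\<^sub>R fact n)" for n x
    proof -
      have "norm (c x) ^ n \<le> C ^ n"
        by (intro power_mono C) auto
      then have "norm (c x) ^ n * norm z ^ n \<le> C ^ n * norm z ^ n"
        by (intro mult_right_mono) auto
      then have "norm (w x) * (norm (c x) ^ n * norm z ^ n) \<le> norm (w x) * (C ^ n * norm z ^ n)"
        by (intro mult_left_mono) auto
      then show ?thesis
        by (simp add: norm_mult norm_power power_mult_distrib field_simps)
    qed
    have ex: "summable (\<lambda>n. (norm z * C) ^ n /\<^sub>R fact n)"
      by (rule summable_exp_generic)
    have intf: "integrable M (?f n)" for n
      using intw[of n] by (rule integrable_mult_left)
    have "(\<lambda>n. LINT x|M. ?f n x) sums (LINT x|M. (\<Sum>n. ?f n x))"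
    proof (rule sums_integral)
      show "AE x in M. summable (\<lambda>n. norm (?f n x))"
        using bd by (intro AE_I2 summable_comparison_test'[OF summable_mult[OF ex]]) auto
      show "summable (\<lambda>n. LINT x|M. norm (?f n x))"
      proof (rule summable_comparison_test')
        show "summable (\<lambda>n. (LINT x|M. norm (w x)) * ((norm z * C) ^ n /\<^sub>R fact n))"
          by (rule summable_mult[OF ex])
        fix n
        have "(LINT x|M. norm (?f n x)) \<le> (LINT x|M. norm (w x) * ((norm z * C) ^ n /\<^sub>R fact n))"
          using w by (intro integral_mono[OF integrable_norm[OF intf] _ bd]) auto
        then show "norm (LINT x|M. norm (?f n x)) \<le> (LINT x|M. norm (w x)) * ((norm z * C) ^ n /\<^sub>R fact n)"
          by (simp add: integral_nonneg_AE)
      qed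
    qed (rule intf)
    moreover have "(\<Sum>n. ?f n x) = w x * exp (z * c x)" for x
    proof -
      have "(\<lambda>n. w x * ((z * c x) ^ n /\<^sub>R fact n)) sums (w x * exp (z * c x))"
        by (intro sums_mult exp_converges)
      then show ?thesis
        by (simp add: sums_iff power_mult_distrib mult_ac scaleR_conv_of_real)
    qed
    ultimately show ?thesis
      by simp
  qed
  \<comment> \<open>The expansion about 0 holds on balls of every radius, and radius
    \<open>norm z + 1\<close> captures the point \<open>z\<close>.\<close>
  have "(\<lambda>z. LINT x|M. w x * exp (z * c x)) holomorphic_on ball 0 \<rho>" for \<rho>
    by (rule power_series_holomorphic, rule sums)
  then have "(\<lambda>z. LINT x|M. w x * exp (z * c x)) field_differentiable (at z)" for z
    by (rule holomorphic_on_imp_differentiable_at[of _ "ball 0 (norm z + 1)"]) auto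
  then show ?thesis
    by (simp add: holomorphic_on_def)
qed

text \<open>Each component of the integral extends to an entire function of \<open>t\<close>, as
  \<open>a\<close> is bounded, and an entire function with uncountably many zeros vanishes
  identically. Uncountability is what a non-null set of parameters provides later.\<close>

lemma trigonometric_integral_zeros:
  fixes p q :: "'a \<Rightarrow> 'b::euclidean_space"
  assumes p: "integrable M p" and q: "integrable M q"
    and [measurable]: "a \<in> borel_measurable M" and C: "\<And>x. \<bar>a x\<bar> \<le> C"
    and unc: "uncountable {t. (LINT x|M. cos (t * a x) *\<^sub>R p x + sin (t * a x) *\<^sub>R q x) = 0}"
  shows "(LINT x|M. cos (t * a x) *\<^sub>R p x + sin (t * a x) *\<^sub>R q x) = 0"
proof -
  have [measurable]: "p \<in> borel_measurable M" "q \<in> borel_measurable M"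
    using p q by (auto dest: borel_measurable_integrable)
  have int: "integrable M (\<lambda>x. cos (t * a x) *\<^sub>R p x + sin (t * a x) *\<^sub>R q x)" for t
  proof (rule Bochner_Integration.integrable_bound)
    show "integrable M (\<lambda>x. norm (p x) + norm (q x))"
      using p q by auto
    show "AE x in M. norm (cos (t * a x) *\<^sub>R p x + sin (t * a x) *\<^sub>R q x) \<le> norm (norm (p x) + norm (q x))"
    proof (rule AE_I2)
      fix x
      have "norm (cos (t * a x) *\<^sub>R p x + sin (t * a x) *\<^sub>R q x) \<le> norm (p x) + norm (q x)"
        by (intro norm_triangle_le add_mono) (auto intro!: mult_left_le_one_le)
      then show "norm (cos (t * a x) *\<^sub>R p x + sin (t * a x) *\<^sub>R q x) \<le> norm (norm (p x) + norm (q x))"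
        by simp
    qed
  qed measurable
  show ?thesis
  proof (rule euclidean_eqI)
    fix b :: 'b
    assume b: "b \<in> Basis"
    txt \<open>\<open>H\<close> is the entire function whose restriction to the real line is the component of the
      integral along \<open>b\<close>.\<close>
    define u v where "u x = complex_of_real (p x \<bullet> b)" and "v x = complex_of_real (q x \<bullet> b)" for x
    define H where "H z = (LINT x|M. ((u x - \<i> * v x) / 2) * exp (z * (\<i> * of_real (a x)))) +
        (LINT x|M. ((u x + \<i> * v x) / 2) * exp (z * - (\<i> * of_real (a x))))" for z
    have iu: "integrable M u" and iv: "integrable M v"
      unfolding u_def v_def using p q by auto
    have iuv: "integrable M (\<lambda>x. (u x - \<i> * v x) / 2)" "integrable M (\<lambda>x. (u x + \<i> * v x) / 2)"
      using iu iv by auto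
    have hol: "H holomorphic_on UNIV"
      unfolding H_def using C
      by (intro holomorphic_on_add holomorphic_integral_exp[where C = C] iuv)
        (auto simp: norm_mult)
    have H: "H (of_real t) =
        of_real ((LINT x|M. cos (t * a x) *\<^sub>R p x + sin (t * a x) *\<^sub>R q x) \<bullet> b)" for t
    proof -
      have ie: "integrable M (\<lambda>x. g x * exp (of_real t * (\<i> * of_real (s * a x))))"
        if g: "integrable M g" for g and s :: real
      proof (rule Bochner_Integration.integrable_bound[OF g])
        have [measurable]: "g \<in> borel_measurable M"
          using g by (rule borel_measurable_integrable)
        show "(\<lambda>x. g x * exp (of_real t * (\<i> * of_real (s * a x)))) \<in> borel_measurable M"
          by measurable
        show "AE x in M. norm (g x * exp (of_real t * (\<i> * of_real (s * a x)))) \<le> norm (g x)"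
          by (intro AE_I2) (simp add: norm_mult norm_exp_eq_Re)
      qed
      have "H (of_real t) = (LINT x|M. ((u x - \<i> * v x) / 2) * exp (of_real t * (\<i> * of_real (a x))) +
          ((u x + \<i> * v x) / 2) * exp (of_real t * - (\<i> * of_real (a x))))"
        unfolding H_def
        using ie[OF iuv(1), of 1] ie[OF iuv(2), of "-1"]
        by (subst Bochner_Integration.integral_add) auto
      also have "\<dots> = (LINT x|M. of_real ((cos (t * a x) *\<^sub>R p x + sin (t * a x) *\<^sub>R q x) \<bullet> b))"
      proof (rule Bochner_Integration.integral_cong[OF refl])
        fix x
        \<comment> \<open>By Euler's formula the coefficients \<open>(u x - \<i> * v x) / 2\<close>
          and \<open>(u x + \<i> * v x) / 2\<close> recombine into cosine times \<open>u x\<close>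
          plus sine times \<open>v x\<close>.\<close>
        have e: "exp (of_real t * (\<i> * of_real (a x))) = cos (of_real (t * a x)) + \<i> * sin (of_real (t * a x))"
          "exp (of_real t * - (\<i> * of_real (a x))) = cos (of_real (t * a x)) - \<i> * sin (of_real (t * a x))"
          using exp_Euler[of "of_real (t * a x)"] exp_Euler[of "- of_real (t * a x)"]
          by (simp_all add: mult_ac)
        show "((u x - \<i> * v x) / 2) * exp (of_real t * (\<i> * of_real (a x))) +
          ((u x + \<i> * v x) / 2) * exp (of_real t * - (\<i> * of_real (a x)))
          = of_real ((cos (t * a x) *\<^sub>R p x + sin (t * a x) *\<^sub>R q x) \<bullet> b)"
          unfolding e u_def v_def
          by (simp add: inner_add_left cos_of_real sin_of_real complex_eq_iff field_simps
               del: of_real_mult)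
      qed
      also have "\<dots> = of_real ((LINT x|M. cos (t * a x) *\<^sub>R p x + sin (t * a x) *\<^sub>R q x) \<bullet> b)"
        using int[of t] by simp
      finally show ?thesis .
    qed
    have "of_real ` {t. (LINT x|M. cos (t * a x) *\<^sub>R p x + sin (t * a x) *\<^sub>R q x) = 0}
        \<subseteq> {z \<in> UNIV. H z = 0}"
      by (auto simp: H)
    then have unc': "uncountable {z \<in> UNIV. H z = 0}"
      using unc countable_subset countable_image_inj_eq[of complex_of_real] inj_of_real inj_on_subset
      by (metis (no_types, lifting) subset_UNIV)
    then have "H constant_on UNIV"
      using holomorphic_countable_zeros[OF hol] fsigma.intros[of "\<lambda>_. UNIV"] by auto
    moreover obtain z where "H z = 0"
      using unc' not_finite_existsD uncountable_infinite by fastforce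
    ultimately have "H (of_real t) = 0"
      by (auto simp: constant_on_def)
    then show "(LINT x|M. cos (t * a x) *\<^sub>R p x + sin (t * a x) *\<^sub>R q x) \<bullet> b = 0 \<bullet> b"
      by (simp add: H del: of_real_mult)
  qed
qed

section \<open>Null sets and coordinate lines\<close>

lemma AE_lborel_translation:
  fixes c :: "'a::euclidean_space"
  shows "(AE x in lborel. P (x + c)) \<longleftrightarrow> (AE x in lborel. P x)"
proof -
  have imp: "AE x in lborel. P (x + c)" if P: "AE x in lborel. P x" for P and c :: 'a
  proof -
    obtain N where N: "\<And>x. x \<in> space lborel - N \<Longrightarrow> P x" "N \<in> null_sets lborel"
      using AE_E3[OF P] by blast
    then have "AE x in distr lborel borel ((+) c). x \<notin> N"
      by (simp add: lborel_distr_plus AE_not_in)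
    then have "AE x in lborel. c + x \<notin> N"
      using N(2) by (subst (asm) AE_distr_iff) auto
    then show ?thesis
      using N(1) by (auto simp: add.commute)
  qed
  from imp[of "\<lambda>x. P (x + c)" "- c", simplified] imp[of P c] show ?thesis
    by blast
qed

text \<open>If the zero set is not null, Fubini yields a non-null set of base points whose line in
  direction \<open>v\<close> meets it in a non-null, hence uncountable, set. So the set \<open>Z B\<close> of points whose
  translate by \<open>span B\<close> consists of zeros stays non-null when directions are added to \<open>B\<close>.\<close>

lemma continuous_zeros_coordinate_lines:
  fixes G :: "'a::euclidean_space \<Rightarrow> 'b::t1_space"
  assumes cont: "continuous_on UNIV G"
    and line: "\<And>\<omega> v t. v \<in> Basis \<Longrightarrow> uncountable {t. G (\<omega> + t *\<^sub>R v) = z} \<Longrightarrow> G (\<omega> + t *\<^sub>R v) = z"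
    and nonnull: "\<not> (AE \<omega> in lborel. G \<omega> \<noteq> z)"
  shows "G \<omega> = z"
proof -
  define Z where "Z B = {\<omega>. \<forall>u\<in>span B. G (\<omega> + u) = z}" for B
  \<comment> \<open>Closedness makes \<open>Z B\<close> Borel, as the exchange of almost-everywhere
    quantifiers below requires.\<close>
  have closed: "closed (Z B)" for B
  proof -
    have "closed {\<omega>. G (\<omega> + u) = z}" for u
    proof -
      have "continuous_on UNIV (\<lambda>\<omega>. G (\<omega> + u))"
        by (intro continuous_on_compose2[OF cont] continuous_intros) auto
      then have "closed ((\<lambda>\<omega>. G (\<omega> + u)) -` {z})"
        by (intro closed_vimage) auto
      then show ?thesis
        by (simp add: vimage_def)
    qed
    moreover have "Z B = (\<Inter>u\<in>span B. {\<omega>. G (\<omega> + u) = z})"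
      by (auto simp: Z_def)
    ultimately show ?thesis
      by auto
  qed
  have "\<not> (AE \<omega> in lborel. \<omega> \<notin> Z B)" if "finite B" "B \<subseteq> Basis" for B
    using that
  proof (induction B)
    case empty
    then show ?case
      using nonnull by (simp add: Z_def)
  next
    case (insert v B)
    have [measurable]: "Z B \<in> sets borel"
      using closed by simp
    show ?case
    proof
      assume null: "AE \<omega> in lborel. \<omega> \<notin> Z (insert v B)"
      have "AE \<omega> in lborel. AE t in lborel. \<omega> + t *\<^sub>R v \<notin> Z B"
        using null
      proof eventually_elim
        case (elim \<omega>)
        show ?case
        proof (rule ccontr)
          assume not: "\<not> (AE t in lborel. \<omega> + t *\<^sub>R v \<notin> Z B)"
          have "uncountable {t. \<omega> + t *\<^sub>R v \<in> Z B}"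
          proof
            assume "countable {t. \<omega> + t *\<^sub>R v \<in> Z B}"
            then have "{t. \<omega> + t *\<^sub>R v \<in> Z B} \<in> null_sets lborel"
              by (rule countable_imp_null_set_lborel)
            from AE_not_in[OF this] not show False
              by simp
          qed
          \<comment> \<open>Modulo \<open>span B\<close>, the vector \<open>u\<close> is a multiple
            \<open>k *\<^sub>R v\<close>. The line through
            \<open>\<omega> + (u - k *\<^sub>R v)\<close> in direction \<open>v\<close> has
            uncountably many zeros, so its point at parameter \<open>k\<close> is a zero
            too.\<close>
          have "G (\<omega> + u) = z" if u: "u \<in> span (insert v B)" for u
          proof -
            obtain k where k: "u - k *\<^sub>R v \<in> span B"
              using u by (auto simp: span_insert)
            have "uncountable {t. G ((\<omega> + (u - k *\<^sub>R v)) + t *\<^sub>R v) = z}"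
            proof
              assume "countable {t. G ((\<omega> + (u - k *\<^sub>R v)) + t *\<^sub>R v) = z}"
              moreover have "{t. \<omega> + t *\<^sub>R v \<in> Z B} \<subseteq> {t. G ((\<omega> + (u - k *\<^sub>R v)) + t *\<^sub>R v) = z}"
                using k by (auto simp: Z_def algebra_simps)
              ultimately show False
                using \<open>uncountable {t. \<omega> + t *\<^sub>R v \<in> Z B}\<close> countable_subset by blast
            qed
            then have "G ((\<omega> + (u - k *\<^sub>R v)) + k *\<^sub>R v) = z"
              using line insert.prems by blast
            then show ?thesis
              by (simp add: algebra_simps)
          qed
          then show False
            using elim by (simp add: Z_def)
        qed
      qed
      \<comment> \<open>After the exchange, the inner set for fixed \<open>t\<close> is a translate
        of \<open>Z B\<close>; whether it is null does not depend on \<open>t\<close>.\<close>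
      then have "AE t in lborel. AE \<omega> in lborel. \<omega> + t *\<^sub>R v \<notin> Z B"
        by (subst lborel_pair.AE_commute[symmetric]) measurable
      then have "AE t in (lborel :: real measure). AE \<omega> in lborel. \<omega> \<notin> Z B"
        using AE_lborel_translation[of "\<lambda>\<omega>. \<omega> \<notin> Z B"] by simp
      then show False
        using insert by (auto simp: eventually_const_iff ae_filter_eq_bot_iff)
    qed
  qed
  \<comment> \<open>As \<open>span Basis\<close> is the whole space, a single point of
    \<open>Z Basis\<close> makes \<open>G\<close> equal to \<open>z\<close> everywhere.\<close>
  from this[OF finite_Basis order_refl] obtain \<omega>' where "\<omega>' \<in> Z Basis"
    by (metis AE_I2)
  then have "G (\<omega>' + (\<omega> - \<omega>')) = z"
    by (simp only: Z_def span_Basis mem_Collect_eq UNIV_I)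
  then show ?thesis
    by simp
qed

section \<open>The two-sided quaternion Fourier transform\<close>

text \<open>Lets the injectivity of the transform be proved by testing against bounded continuous
  functions only.\<close>

lemma AE_zero_if_orthogonal_to_continuous:
  fixes u :: "'a::euclidean_space \<Rightarrow> real"
  assumes u: "integrable lborel u"
    and orth: "\<And>f. continuous_on UNIV f \<Longrightarrow> (\<And>x. \<bar>f x\<bar> \<le> 1) \<Longrightarrow> (LINT x|lborel. f x * u x) = 0"
  shows "AE x in lborel. u x = 0"
proof -
  have [measurable]: "u \<in> borel_measurable borel"
    using u by (auto dest: borel_measurable_integrable)
  txt \<open>Test against truncated continuous approximations of the sign of \<open>u\<close>.\<close>
  have "(\<lambda>x. sgn (u x)) \<in> borel_measurable lebesgue"
    by (intro measurable_completion) simp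
  then have "(\<lambda>x. sgn (u x)) measurable_on UNIV"
    by (intro lebesgue_measurable_imp_measurable_on) auto
  then obtain N \<psi> where N: "negligible N" and \<psi>: "\<And>n::nat. continuous_on UNIV (\<psi> n)"
    and lim: "\<And>x. x \<notin> N \<Longrightarrow> (\<lambda>n. \<psi> n x) \<longlonglongrightarrow> sgn (u x)"
    unfolding measurable_on_def by auto
  \<comment> \<open>Truncation to [-1, 1] keeps \<open>\<bar>u x\<bar>\<close> as a dominating
    function and does not move the limit, since \<open>sgn\<close> takes values in this
    interval.\<close>
  define f where "f n x = max (- 1) (min 1 (\<psi> n x))" for n x
  have cont: "continuous_on UNIV (f n)" for n
    unfolding f_def using \<psi> by (intro continuous_intros)
  then have [measurable]: "f n \<in> borel_measurable borel" for n
    by (rule borel_measurable_continuous_onI)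
  have le: "\<bar>f n x\<bar> \<le> 1" for n x
    by (auto simp: f_def)
  have "(\<lambda>n. LINT x|lborel. f n x * u x) \<longlonglongrightarrow> (LINT x|lborel. \<bar>u x\<bar>)"
  proof (rule integral_dominated_convergence)
    show "integrable lborel (\<lambda>x. \<bar>u x\<bar>)"
      using u by simp
    show "AE x in lborel. norm (f n x * u x) \<le> \<bar>u x\<bar>" for n
      using le by (intro AE_I2) (auto simp: abs_mult intro: mult_left_le_one_le)
    have "AE x in lebesgue. x \<notin> N"
      using N by (intro AE_not_in) (simp add: negligible_iff_null_sets)
    then have "AE x in lborel. x \<notin> N"
      by (simp add: AE_completion_iff)
    then show "AE x in lborel. (\<lambda>n. f n x * u x) \<longlonglongrightarrow> \<bar>u x\<bar>"
    proof eventually_elim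
      case (elim x)
      have "(\<lambda>n. f n x * u x) \<longlonglongrightarrow> max (- 1) (min 1 (sgn (u x))) * u x"
        unfolding f_def by (intro tendsto_intros lim elim)
      also have "max (- 1) (min 1 (sgn (u x))) * u x = \<bar>u x\<bar>"
        by (auto simp: sgn_if)
      finally show ?case .
    qed
  qed measurable
  moreover have "(LINT x|lborel. f n x * u x) = 0" for n
    by (rule orth[OF cont le])
  ultimately have "(LINT x|lborel. \<bar>u x\<bar>) = 0"
    by (simp add: LIMSEQ_const_iff)
  then have "AE x in lborel. \<bar>u x\<bar> = 0"
    using u by (subst (asm) integral_nonneg_eq_0_iff_AE) auto
  then show ?thesis
    by simp
qed

section \<open>Exponentials of imaginary units and the kernel of the transform\<close>

text \<open>Even powers of \<open>u\<close> are real scalars and odd ones are real multiples of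
  \<open>u\<close>, so the exponential series splits into the cosine and sine series. This serves
  \<open>quat_i\<close> and \<open>quat_j\<close> alike.\<close>

lemma exp_scaleR_imaginary_unit:
  fixes u :: "'a::{real_normed_algebra_1,banach}"
  assumes u: "u * u = - 1"
  shows "exp (t *\<^sub>R u) = cos t *\<^sub>R 1 + sin t *\<^sub>R u"
proof -
  have even: "u ^ (k * 2) = (- 1) ^ k *\<^sub>R 1" for k
    using u by (simp add: mult.commute[of k] power_mult power2_eq_square flip: of_real_def)
  have "(\<lambda>n. (cos_coeff n *\<^sub>R t ^ n) *\<^sub>R (1::'a) + (sin_coeff n *\<^sub>R t ^ n) *\<^sub>R u)
      sums (cos t *\<^sub>R 1 + sin t *\<^sub>R u)"
    by (intro sums_add sums_scaleR_left cos_converges sin_converges)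
  moreover have "(cos_coeff n *\<^sub>R t ^ n) *\<^sub>R (1::'a) + (sin_coeff n *\<^sub>R t ^ n) *\<^sub>R u
      = (t *\<^sub>R u) ^ n /\<^sub>R fact n" for n
  proof (cases "even n")
    case True
    then obtain k where "n = 2 * k"
      by blast
    then show ?thesis
      by (simp add: cos_coeff_def sin_coeff_def scaleR_power even divide_inverse mult_ac)
  next
    case False
    then obtain k where "n = 2 * k + 1"
      by (auto elim: oddE)
    then show ?thesis
      by (simp add: cos_coeff_def sin_coeff_def scaleR_power even divide_inverse mult_ac power_add)
  qed
  ultimately have "(\<lambda>n. (t *\<^sub>R u) ^ n /\<^sub>R fact n) sums (cos t *\<^sub>R 1 + sin t *\<^sub>R u)"
    by simp
  then show ?thesis
    using exp_converges sums_unique2 by blast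
qed

lemmas exp_quat_i = exp_scaleR_imaginary_unit[OF quat_units(1)]
  and exp_quat_j = exp_scaleR_imaginary_unit[OF quat_units(2)]

lemma norm_exp_quat [simp]: "norm (exp (t *\<^sub>R quat_i)) = 1" "norm (exp (t *\<^sub>R quat_j)) = 1"
  unfolding exp_quat_i exp_quat_j
  by (simp_all add: norm_quat_def inner_quat_def quat_i_def quat_j_def flip: power2_eq_square)

lemma exp_scaleR_add_left:
  fixes u :: "'a::{real_normed_algebra_1,banach}"
  shows "exp ((s + t) *\<^sub>R u) = exp (s *\<^sub>R u) * exp (t *\<^sub>R u)"
  by (simp add: scaleR_add_left exp_add_commuting)

definition qft_integrand :: "(real^2 \<Rightarrow> quat) \<Rightarrow> real^2 \<Rightarrow> real^2 \<Rightarrow> quat" where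
  "qft_integrand g \<omega> x = exp ((- 2 * pi * (x $ 1) * (\<omega> $ 1)) *\<^sub>R quat_i) * g x
     * exp ((- 2 * pi * (x $ 2) * (\<omega> $ 2)) *\<^sub>R quat_j)"

text \<open>Taken for functions rather than classes and over \<open>lborel\<close>: it is applied to
  products of Borel representatives, where Fubini is available.\<close>

definition qft :: "(real^2 \<Rightarrow> quat) \<Rightarrow> real^2 \<Rightarrow> quat" where
  "qft g \<omega> = (LINT x|lborel. qft_integrand g \<omega> x)"

text \<open>Euler's four-square identity. Equality, not just the inequality of a normed algebra,
  shows that the exponential factors preserve the modulus and that a vanishing product has a
  vanishing factor.\<close>

lemma norm_quat_mult: "norm (x * y) = norm x * norm (y::quat)"
proof -
  have "(norm (x * y))\<^sup>2 = (norm x * norm y)\<^sup>2"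
    by (simp add: norm_quat_def inner_quat_def quat_mult_sel power_mult_distrib)
      (simp add: algebra_simps power2_eq_square)
  then show ?thesis
    by (simp add: power2_eq_iff_nonneg)
qed

lemma norm_qft_integrand [simp]: "norm (qft_integrand g \<omega> x) = norm (g x)"
  unfolding qft_integrand_def norm_quat_mult norm_exp_quat by simp

lemma borel_measurable_qft_integrand [measurable]:
  assumes [measurable]: "g \<in> borel_measurable borel"
  shows "qft_integrand g \<omega> \<in> borel_measurable borel"
proof -
  have [measurable]: "(\<lambda>x::real^2. x $ k) \<in> borel_measurable borel" for k
    by (intro borel_measurable_continuous_onI continuous_intros)
  show ?thesis
    unfolding qft_integrand_def[abs_def] exp_quat_i exp_quat_j by measurable
qed

lemma integrable_qft_integrand:
  assumes "integrable lborel g"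
  shows "integrable lborel (qft_integrand g \<omega>)"
  using assms borel_measurable_integrable[OF assms]
  by (intro Bochner_Integration.integrable_bound[OF assms]) auto

lemma continuous_on_qft:
  assumes g: "integrable lborel g"
  shows "continuous_on UNIV (qft g)"
proof -
  have [measurable]: "g \<in> borel_measurable borel"
    using g by (auto dest: borel_measurable_integrable)
  have "(\<lambda>n. qft g (w n)) \<longlonglongrightarrow> qft g \<omega>" if w: "w \<longlonglongrightarrow> \<omega>" for w \<omega>
    unfolding qft_def
  proof (rule integral_dominated_convergence)
    show "integrable lborel (\<lambda>x. norm (g x))"
      using g by simp
    show "AE x in lborel. (\<lambda>n. qft_integrand g (w n) x) \<longlonglongrightarrow> qft_integrand g \<omega> x"
      unfolding qft_integrand_def exp_quat_i exp_quat_j by (intro AE_I2 tendsto_intros w)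
  qed auto
  then show ?thesis
    by (auto simp: continuous_on_sequentially o_def)
qed

text \<open>As quaternions do not commute, a shift of the first frequency comes out on the left of
  the kernel and one of the second on the right. The summands in the exponents are ordered so that
  the new factor lands on that side.\<close>

lemma qft_integrand_shift:
  "qft_integrand g (\<omega> + t *\<^sub>R axis 1 1) x =
     exp ((t * (- 2 * pi * x $ 1)) *\<^sub>R quat_i) * qft_integrand g \<omega> x"
  "qft_integrand g (\<omega> + t *\<^sub>R axis 2 1) x =
     qft_integrand g \<omega> x * exp ((t * (- 2 * pi * x $ 2)) *\<^sub>R quat_j)"
proof -
  have "- 2 * pi * x $ 1 * (\<omega> + t *\<^sub>R axis 1 1) $ 1 = t * (- 2 * pi * x $ 1) + - 2 * pi * x $ 1 * \<omega> $ 1"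
    "(\<omega> + t *\<^sub>R axis 1 1) $ 2 = \<omega> $ 2"
    by (simp_all add: algebra_simps axis_def)
  then show "qft_integrand g (\<omega> + t *\<^sub>R axis 1 1) x =
     exp ((t * (- 2 * pi * x $ 1)) *\<^sub>R quat_i) * qft_integrand g \<omega> x"
    unfolding qft_integrand_def by (simp only: exp_scaleR_add_left mult.assoc)
  have "- 2 * pi * x $ 2 * (\<omega> + t *\<^sub>R axis 2 1) $ 2 = - 2 * pi * x $ 2 * \<omega> $ 2 + t * (- 2 * pi * x $ 2)"
    "(\<omega> + t *\<^sub>R axis 2 1) $ 1 = \<omega> $ 1"
    by (simp_all add: algebra_simps axis_def)
  then show "qft_integrand g (\<omega> + t *\<^sub>R axis 2 1) x =
     qft_integrand g \<omega> x * exp ((t * (- 2 * pi * x $ 2)) *\<^sub>R quat_j)"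
    unfolding qft_integrand_def by (simp only: exp_scaleR_add_left mult.assoc)
qed

lemma Basis_real2: "v \<in> (Basis :: (real^2) set) \<Longrightarrow> v = axis 1 1 \<or> v = axis 2 1"
  by (auto simp: Basis_vec_def) (metis exhaust_2)

section \<open>Zeros on lines and injectivity of the transform\<close>

text \<open>By the shift and Euler formulas, the transform on a coordinate line is a trigonometric
  integral in \<open>t\<close> whose amplitudes are \<open>qft_integrand g \<omega>\<close> and its
  product with \<open>quat_i\<close> on the left or \<open>quat_j\<close> on the right. The bounded
  support of \<open>g\<close> keeps the frequencies bounded.\<close>

lemma qft_zeros_on_lines:
  assumes g: "integrable lborel g" and supp: "\<And>x. C < norm x \<Longrightarrow> g x = 0"
    and v: "v \<in> Basis" and unc: "uncountable {t. qft g (\<omega> + t *\<^sub>R v) = 0}"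
  shows "qft g (\<omega> + t *\<^sub>R v) = 0"
proof -
  \<comment> \<open>The frequency must be bounded on the whole plane; setting it to 0 where
    \<open>g\<close> vanishes does not change the integral.\<close>
  define a where "a k x = (if norm x \<le> C then - 2 * pi * x $ k else 0)" for k and x :: "real^2"
  have a [measurable]: "a k \<in> borel_measurable lborel" for k
  proof -
    have [measurable]: "(\<lambda>x::real^2. x $ k) \<in> borel_measurable borel"
      by (intro borel_measurable_continuous_onI continuous_intros)
    show ?thesis
      unfolding a_def[abs_def] by measurable
  qed
  have bound: "\<bar>a k x\<bar> \<le> 2 * pi * \<bar>C\<bar>" for k x
  proof (cases "norm x \<le> C")
    case True
    then have "\<bar>x $ k\<bar> \<le> \<bar>C\<bar>"
      using component_le_norm_cart[of x k] by linarith
    with True show ?thesis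
      by (simp add: a_def abs_mult)
  qed (simp add: a_def)
  have zero: "qft_integrand g \<omega> x = 0" if "\<not> norm x \<le> C" for x
    using supp[of x] that by (simp add: qft_integrand_def)
  have "\<exists>(a :: real^2 \<Rightarrow> real) p q. a \<in> borel_measurable lborel \<and> (\<forall>x. \<bar>a x\<bar> \<le> 2 * pi * \<bar>C\<bar>)
      \<and> integrable lborel p \<and> integrable lborel q
      \<and> (\<forall>t. qft g (\<omega> + t *\<^sub>R v) = (LINT x|lborel. cos (t * a x) *\<^sub>R p x + sin (t * a x) *\<^sub>R q x))"
    using Basis_real2[OF v]
  proof
    assume v: "v = axis 1 1"
    have "qft_integrand g (\<omega> + t *\<^sub>R v) x = cos (t * a 1 x) *\<^sub>R qft_integrand g \<omega> x
        + sin (t * a 1 x) *\<^sub>R (quat_i * qft_integrand g \<omega> x)" for t x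
      using zero[of x] unfolding v qft_integrand_shift exp_quat_i
      by (cases "norm x \<le> C") (simp_all add: a_def left_diff_distrib)
    then have "\<forall>t. qft g (\<omega> + t *\<^sub>R v) = (LINT x|lborel. cos (t * a 1 x) *\<^sub>R qft_integrand g \<omega> x
        + sin (t * a 1 x) *\<^sub>R (quat_i * qft_integrand g \<omega> x))"
      by (simp add: qft_def)
    moreover have "integrable lborel (\<lambda>x. quat_i * qft_integrand g \<omega> x)"
      by (intro integrable_mult_left integrable_mult_right integrable_qft_integrand g)
    ultimately show ?thesis
      using bound[of 1] integrable_qft_integrand[OF g] a by blast
  next
    assume v: "v = axis 2 1"
    have "qft_integrand g (\<omega> + t *\<^sub>R v) x = cos (t * a 2 x) *\<^sub>R qft_integrand g \<omega> x
        + sin (t * a 2 x) *\<^sub>R (qft_integrand g \<omega> x * quat_j)" for t x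
      using zero[of x] unfolding v qft_integrand_shift exp_quat_j
      by (cases "norm x \<le> C") (simp_all add: a_def right_diff_distrib)
    then have "\<forall>t. qft g (\<omega> + t *\<^sub>R v) = (LINT x|lborel. cos (t * a 2 x) *\<^sub>R qft_integrand g \<omega> x
        + sin (t * a 2 x) *\<^sub>R (qft_integrand g \<omega> x * quat_j))"
      by (simp add: qft_def)
    moreover have "integrable lborel (\<lambda>x. qft_integrand g \<omega> x * quat_j)"
      by (intro integrable_mult_left integrable_mult_right integrable_qft_integrand g)
    ultimately show ?thesis
      using bound[of 2] integrable_qft_integrand[OF g] a by blast
  qed
  then obtain a :: "real^2 \<Rightarrow> real" and p q where "a \<in> borel_measurable lborel" "\<forall>x. \<bar>a x\<bar> \<le> 2 * pi * \<bar>C\<bar>"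
    "integrable lborel p" "integrable lborel q"
    and eq: "\<And>t. qft g (\<omega> + t *\<^sub>R v) = (LINT x|lborel. cos (t * a x) *\<^sub>R p x + sin (t * a x) *\<^sub>R q x)"
    by blast
  then show ?thesis
    using trigonometric_integral_zeros[of lborel p q a] unc unfolding eq by blast
qed

text \<open>Multiplication by a sine combines two frequency shifts, up to a factor \<open>i\<close> on the left or \<open>j\<close> on the
  right of the kernel.\<close>

lemma qft_sin_mult_zero:
  assumes g: "integrable lborel g" and zero: "\<And>\<omega>. qft g \<omega> = 0"
  shows "qft (\<lambda>x. sin (t * (- 2 * pi * x $ k)) *\<^sub>R g x) \<omega> = 0"
proof -
  define D where "D v x = qft_integrand g (\<omega> + t *\<^sub>R v) x - qft_integrand g (\<omega> + (- t) *\<^sub>R v) x" for v x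
  have int: "integrable lborel (D v)" for v
    unfolding D_def by (intro Bochner_Integration.integrable_diff integrable_qft_integrand g)
  have D: "(LINT x|lborel. D v x) = 0" for v
    using zero unfolding D_def qft_def
    by (subst Bochner_Integration.integral_diff) (auto intro: integrable_qft_integrand g)
  consider "k = 1" | "k = 2"
    using exhaust_2 by blast
  then show ?thesis
  proof cases
    case 1
    \<comment> \<open>The difference \<open>D\<close> is twice the sine times \<open>quat_i\<close>;
      since \<open>quat_i * quat_i = - 1\<close>, the factor
      \<open>(- 1 / 2) *\<^sub>R quat_i\<close> turns it back into the plain sine multiple.\<close>
    have "qft_integrand (\<lambda>x. sin (t * (- 2 * pi * x $ k)) *\<^sub>R g x) \<omega> x
        = ((- 1 / 2) *\<^sub>R quat_i) * D (axis 1 1) x" for x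
    proof -
      have "D (axis 1 1) x = (2 * sin (t * (- 2 * pi * x $ 1))) *\<^sub>R (quat_i * qft_integrand g \<omega> x)"
        unfolding D_def qft_integrand_shift exp_quat_i
        by (simp add: algebra_simps flip: scaleR_2)
      then show ?thesis
        by (simp add: 1 qft_integrand_def quat_units flip: mult.assoc)
    qed
    then show ?thesis
      using D int by (simp add: qft_def)
  next
    case 2
    have "qft_integrand (\<lambda>x. sin (t * (- 2 * pi * x $ k)) *\<^sub>R g x) \<omega> x
        = D (axis 2 1) x * ((- 1 / 2) *\<^sub>R quat_j)" for x
    proof -
      have "D (axis 2 1) x = (2 * sin (t * (- 2 * pi * x $ 2))) *\<^sub>R (qft_integrand g \<omega> x * quat_j)"
        unfolding D_def qft_integrand_shift exp_quat_j
        by (simp add: algebra_simps flip: scaleR_2)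
      then show ?thesis
        by (simp add: 2 qft_integrand_def quat_units mult.assoc)
    qed
    then show ?thesis
      using D int by (simp add: qft_def)
  qed
qed

lemma AE_zero_if_qft_zero:
  assumes g: "integrable lborel g" and supp: "\<And>x. C < norm x \<Longrightarrow> g x = 0"
    and zero: "\<And>\<omega>. qft g \<omega> = 0"
  shows "AE x in lborel. g x = 0"
proof -
  txt \<open>The continuous multipliers \<open>P\<close> of the kernel \<open>N\<close> of the transform form an algebra separating
    points, so Stone-Weierstrass applies on the ball carrying \<open>g\<close>.\<close>
  define N where "N = {h. integrable lborel h \<and> (\<forall>\<omega>. qft h \<omega> = 0)}"
  define P where "P \<psi> \<longleftrightarrow> continuous_on (cball 0 C) \<psi> \<and> (\<forall>h\<in>N. (\<lambda>x. \<psi> x *\<^sub>R h x) \<in> N)"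
    for \<psi> :: "real^2 \<Rightarrow> real"
  have gN: "g \<in> N"
    using g zero by (simp add: N_def)
  have orth: "(LINT x|lborel. f x *\<^sub>R g x) = 0"
    if cont: "continuous_on UNIV f" and f1: "\<And>x. \<bar>f x\<bar> \<le> 1" for f :: "real^2 \<Rightarrow> real"
  proof -
    have approx: "\<exists>\<psi>. P \<psi> \<and> (\<forall>x\<in>cball 0 C. \<bar>f x - \<psi> x\<bar> < e)" if "0 < e" for e
    proof (rule Stone_Weierstrass_HOL)
      show "P (\<lambda>x. c)" for c
      proof -
        have "qft_integrand (\<lambda>x. c *\<^sub>R h x) \<omega> = (\<lambda>x. c *\<^sub>R qft_integrand h \<omega> x)" for h \<omega>
          by (simp add: qft_integrand_def fun_eq_iff)
        then show ?thesis
          by (auto simp: P_def N_def qft_def)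
      qed
      show "P (\<lambda>x. \<psi>1 x + \<psi>2 x)" if "P \<psi>1 \<and> P \<psi>2" for \<psi>1 \<psi>2
      proof -
        have "qft_integrand (\<lambda>x. h1 x + h2 x) \<omega> = (\<lambda>x. qft_integrand h1 \<omega> x + qft_integrand h2 \<omega> x)" for h1 h2 \<omega>
          by (simp add: qft_integrand_def algebra_simps fun_eq_iff)
        then have "(\<lambda>x. h1 x + h2 x) \<in> N" if "h1 \<in> N" "h2 \<in> N" for h1 h2
          using that by (auto simp: N_def qft_def integrable_qft_integrand)
        moreover have "continuous_on (cball 0 C) (\<lambda>x. \<psi>1 x + \<psi>2 x)"
          using that unfolding P_def by (intro continuous_on_add) auto
        ultimately show ?thesis
          using that by (simp add: P_def scaleR_add_left)
      qed
      show "P (\<lambda>x. \<psi>1 x * \<psi>2 x)" if "P \<psi>1 \<and> P \<psi>2" for \<psi>1 \<psi>2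
        using that by (auto simp: P_def intro: continuous_intros simp flip: scaleR_scaleR)
      show "\<exists>\<psi>. P \<psi> \<and> \<psi> x \<noteq> \<psi> y" if xy: "x \<in> cball 0 C \<and> y \<in> cball 0 C \<and> x \<noteq> y" for x y
      proof -
        obtain k where k: "x $ k \<noteq> y $ k"
          using xy by (auto simp: vec_eq_iff)
        have C: "0 \<le> C"
          using xy norm_ge_zero order_trans by (auto simp del: norm_ge_zero)
        \<comment> \<open>With this \<open>t\<close>, \<open>2 * pi * (C + 1)\<close> is scaled to
          \<open>pi / 2\<close>, so on the ball all arguments lie where the sine is injective;
          adding 1 keeps the denominator positive for \<open>C = 0\<close>.\<close>
        define t where "t = 1 / (4 * (C + 1))"
        have "P (\<lambda>x. sin (t * (- 2 * pi * x $ k)))"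
        proof -
          have "(\<lambda>x. sin (t * (- 2 * pi * x $ k)) *\<^sub>R h x) \<in> N" if "h \<in> N" for h
          proof -
            have h: "integrable lborel h" "\<And>\<omega>. qft h \<omega> = 0"
              using that by (auto simp: N_def)
            have [measurable]: "(\<lambda>x::real^2. x $ k) \<in> borel_measurable borel"
              by (intro borel_measurable_continuous_onI continuous_intros)
            have [measurable]: "h \<in> borel_measurable borel"
              using h(1) by (auto dest: borel_measurable_integrable)
            have "integrable lborel (\<lambda>x. sin (t * (- 2 * pi * x $ k)) *\<^sub>R h x)"
              by (rule Bochner_Integration.integrable_bound[OF h(1)])
                (auto intro!: mult_left_le_one_le)
            with qft_sin_mult_zero[OF h] show ?thesis
              by (simp add: N_def)
          qed
          then show ?thesis
            by (auto simp: P_def intro!: continuous_intros)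
        qed
        moreover have "sin (t * (- 2 * pi * x $ k)) \<noteq> sin (t * (- 2 * pi * y $ k))"
        proof -
          have "\<bar>t * (- 2 * pi * z $ k)\<bar> \<le> pi / 2" if "z \<in> cball 0 C" for z
          proof -
            have "\<bar>z $ k\<bar> \<le> C + 1"
              using that component_le_norm_cart[of z k] by auto
            then have "2 * pi * \<bar>z $ k\<bar> \<le> 2 * pi * (C + 1)"
              by (intro mult_left_mono) auto
            then show ?thesis
              using C by (simp add: t_def abs_mult field_simps)
          qed
          then have "\<bar>t * (- 2 * pi * x $ k)\<bar> \<le> pi / 2" "\<bar>t * (- 2 * pi * y $ k)\<bar> \<le> pi / 2"
            using xy by blast+
          moreover have "a = b" if "sin a = sin b" "\<bar>a\<bar> \<le> pi / 2" "\<bar>b\<bar> \<le> pi / 2" for a b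
            using that by (auto simp: abs_le_iff intro!: sin_inj_pi[of a b])
          ultimately have "sin (t * (- 2 * pi * x $ k)) = sin (t * (- 2 * pi * y $ k)) \<Longrightarrow>
              t * (- 2 * pi * x $ k) = t * (- 2 * pi * y $ k)"
            by blast
          then show ?thesis
            using k C by (auto simp: t_def)
        qed
        ultimately show ?thesis
          by blast
      qed
      show "continuous_on (cball 0 C) f"
        using cont continuous_on_subset by blast
    qed (use that in \<open>auto simp: P_def\<close>)
    have [measurable]: "f \<in> borel_measurable borel" "g \<in> borel_measurable borel"
      using cont g by (auto dest: borel_measurable_integrable intro: borel_measurable_continuous_onI)
    have fg: "integrable lborel (\<lambda>x. f x *\<^sub>R g x)"
      using f1 by (intro Bochner_Integration.integrable_bound[OF g])
        (auto intro!: mult_left_le_one_le)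
    \<comment> \<open>A multiplier \<open>\<psi>\<close> close to \<open>f\<close> on the ball
      replaces \<open>f\<close>: the integral against \<open>\<psi>\<close> is zero, and the error
      is at most \<open>e\<close> times the integral of \<open>norm (g x)\<close>, since
      \<open>g\<close> vanishes off the ball.\<close>
    have "norm (LINT x|lborel. f x *\<^sub>R g x) \<le> e * (LINT x|lborel. norm (g x))" if e: "0 < e" for e
    proof -
      obtain \<psi> where "P \<psi>" and close: "\<And>x. x \<in> cball 0 C \<Longrightarrow> \<bar>f x - \<psi> x\<bar> < e"
        using approx[OF e] by blast
      then have \<psi>: "integrable lborel (\<lambda>x. \<psi> x *\<^sub>R g x)" "qft (\<lambda>x. \<psi> x *\<^sub>R g x) 0 = 0"
        using gN by (auto simp: P_def N_def)
      \<comment> \<open>At frequency 0 both exponentials are 1, so the transform is the plain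
        integral.\<close>
      have "(LINT x|lborel. \<psi> x *\<^sub>R g x) = 0"
        using \<psi>(2) by (simp add: qft_def qft_integrand_def)
      then have "(LINT x|lborel. f x *\<^sub>R g x) = (LINT x|lborel. f x *\<^sub>R g x - \<psi> x *\<^sub>R g x)"
        using fg \<psi>(1) by simp
      also have "norm \<dots> \<le> (LINT x|lborel. norm (f x *\<^sub>R g x - \<psi> x *\<^sub>R g x))"
        by (rule integral_norm_bound)
      also have "\<dots> \<le> (LINT x|lborel. e * norm (g x))"
      proof (rule integral_mono)
        show "integrable lborel (\<lambda>x. norm (f x *\<^sub>R g x - \<psi> x *\<^sub>R g x))"
          using fg \<psi>(1) by simp
        show "integrable lborel (\<lambda>x. e * norm (g x))"
          using g by simp
        show "norm (f x *\<^sub>R g x - \<psi> x *\<^sub>R g x) \<le> e * norm (g x)" for x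
        proof (cases "norm x \<le> C")
          case True
          then have "\<bar>f x - \<psi> x\<bar> \<le> e"
            using close[of x] by simp
          then show ?thesis
            by (simp add: mult_right_mono flip: scaleR_diff_left)
        qed (use supp in simp)
      qed
      finally show ?thesis
        by simp
    qed
    then have "norm (LINT x|lborel. f x *\<^sub>R g x) \<le> 0"
    proof -
      let ?I = "LINT x|lborel. norm (g x)"
      have I: "0 \<le> ?I"
        by simp
      have "norm (LINT x|lborel. f x *\<^sub>R g x) \<le> 0 + e" if "0 < e" for e
      proof -
        \<comment> \<open>The denominator \<open>?I + 1\<close> allows for
          \<open>?I = 0\<close>.\<close>
        have "0 < e / (?I + 1)"
          using that I by (intro divide_pos_pos) linarith+
        then have "norm (LINT x|lborel. f x *\<^sub>R g x) \<le> e / (?I + 1) * ?I"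
          by (rule \<open>\<And>e. 0 < e \<Longrightarrow> norm (LINT x|lborel. f x *\<^sub>R g x) \<le> e * ?I\<close>)
        also have "\<dots> \<le> e"
        proof -
          have pos: "0 < ?I + 1"
            using I by linarith
          have "e * ?I \<le> e * (?I + 1)"
            using that by (intro mult_left_mono) auto
          then show ?thesis
            by (simp add: pos_divide_le_eq[OF pos])
        qed
        finally show ?thesis
          by simp
      qed
      then show ?thesis
        by (rule field_le_epsilon)
    qed
    then show ?thesis
      by simp
  qed
  have "AE x in lborel. g x \<bullet> b = 0" for b
  proof (rule AE_zero_if_orthogonal_to_continuous)
    show "integrable lborel (\<lambda>x. g x \<bullet> b)"
      using g by simp
    fix f :: "real^2 \<Rightarrow> real"
    assume f: "continuous_on UNIV f" "\<And>x. \<bar>f x\<bar> \<le> 1"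
    have [measurable]: "f \<in> borel_measurable borel" "g \<in> borel_measurable borel"
      using f g by (auto dest: borel_measurable_integrable intro: borel_measurable_continuous_onI)
    have "integrable lborel (\<lambda>x. f x *\<^sub>R g x)"
      using f(2) by (intro Bochner_Integration.integrable_bound[OF g])
        (auto intro!: mult_left_le_one_le)
    then have "(LINT x|lborel. (f x *\<^sub>R g x) \<bullet> b) = (LINT x|lborel. f x *\<^sub>R g x) \<bullet> b"
      by (rule integral_inner_left)
    then show "(LINT x|lborel. f x * (g x \<bullet> b)) = 0"
      using orth[OF f] by simp
  qed
  then have "AE x in lborel. \<forall>b\<in>Basis. g x \<bullet> b = 0"
    by (simp add: AE_finite_all)
  then show ?thesis
    by eventually_elim (simp add: euclidean_all_zero_iff)
qed

section \<open>The Gabor transform\<close>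

text \<open>Prepares for Fubini, which is applied on products of \<open>lborel\<close>. Taking
  components reduces the claim to real-valued functions.\<close>

lemma lebesgue_ex_borel_measurable:
  fixes f :: "'a::euclidean_space \<Rightarrow> 'b::euclidean_space"
  assumes f: "f \<in> borel_measurable lebesgue"
  obtains g where "g \<in> borel_measurable borel" "AE x in lborel. f x = g x"
proof -
  have "\<exists>h\<in>borel_measurable lborel. AE x in lborel. f x \<bullet> b = h x" for b
    using f by (intro completion_ex_borel_measurable_real) auto
  then obtain h where h: "\<And>b. h b \<in> borel_measurable lborel" "\<And>b. AE x in lborel. f x \<bullet> b = h b x"
    by metis
  show ?thesis
  proof
    show "(\<lambda>x. \<Sum>b\<in>Basis. h b x *\<^sub>R b) \<in> borel_measurable borel"
      using h(1) by (intro borel_measurable_sum borel_measurable_scaleR) auto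
    have "AE x in lborel. \<forall>b\<in>Basis. f x \<bullet> b = h b x"
      using h(2) by (simp add: AE_finite_all)
    then show "AE x in lborel. f x = (\<Sum>b\<in>Basis. h b x *\<^sub>R b)"
    proof eventually_elim
      case (elim x)
      have "f x = (\<Sum>b\<in>Basis. (f x \<bullet> b) *\<^sub>R b)"
        by (rule euclidean_representation[symmetric])
      also have "\<dots> = (\<Sum>b\<in>Basis. h b x *\<^sub>R b)"
        using elim by (intro sum.cong) auto
      finally show ?case .
    qed
  qed
qed

text \<open>The complement of the essential support is a union of possibly uncountably many open
  sets. Lindelof's theorem extracts countably many with the same union, so the exceptional null sets
  can be joined.\<close>

lemma AE_zero_outside_ess_supp: "AE x in lebesgue. x \<notin> ess_supp F \<longrightarrow> L2_fun F x = 0"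
proof -
  let ?\<U> = "{U. open U \<and> (AE x in lebesgue. x \<in> U \<longrightarrow> L2_fun F x = 0)}"
  obtain \<V> where \<V>: "\<V> \<subseteq> ?\<U>" "countable \<V>" "\<Union>\<V> = \<Union>?\<U>"
    using Lindelof[of ?\<U>] by auto
  have "AE x in lebesgue. \<forall>U\<in>\<V>. x \<in> U \<longrightarrow> L2_fun F x = 0"
    using \<V>(1) by (subst AE_ball_countable[OF \<V>(2)]) auto
  then show ?thesis
  proof eventually_elim
    case (elim x)
    then show ?case
      using \<V>(3) by (auto simp: ess_supp_def)
  qed
qed

text \<open>Expresses conjugation through the inner product with 1, so that its measurability
  follows from standard operations.\<close>

lemma qcnj_altdef: "qcnj x = (2 * (x \<bullet> 1)) *\<^sub>R 1 - x"
  by (simp add: qcnj_def quat_eq_iff inner_quat_def)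

lemma borel_measurable_qcnj [measurable]:
  "f \<in> borel_measurable M \<Longrightarrow> (\<lambda>x. qcnj (f x)) \<in> borel_measurable M"
  unfolding qcnj_altdef
  by (intro borel_measurable_diff borel_measurable_scaleR borel_measurable_times
      borel_measurable_inner borel_measurable_const)

lemma norm_qcnj [simp]: "norm (qcnj x) = norm x"
  by (simp add: norm_quat_def inner_quat_def qcnj_def)

text \<open>Lebesgue measurability need not survive composition with a Borel map; a translation is
  handled as the affine map with all coefficients 1.\<close>

lemma borel_measurable_lebesgue_translation:
  fixes f :: "'a::euclidean_space \<Rightarrow> 'b::topological_space"
  assumes "f \<in> borel_measurable lebesgue"
  shows "(\<lambda>x. f (x - b)) \<in> borel_measurable lebesgue"
proof -
  have "(\<lambda>x. - b + (\<Sum>j\<in>Basis. (1 * (x \<bullet> j)) *\<^sub>R j)) \<in> lebesgue \<rightarrow>\<^sub>M lebesgue"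
    by (rule lebesgue_affine_measurable) simp
  then have "(\<lambda>x. x - b) \<in> lebesgue \<rightarrow>\<^sub>M (lebesgue :: 'a measure)"
    by (simp add: euclidean_representation)
  from measurable_compose[OF this assms] show ?thesis .
qed

text \<open>For each fixed \<open>b\<close>, changing representatives alters the integrand only on a
  null set, so the identity holds at every point \<open>(\<omega>, b)\<close>.\<close>

lemma gqft_eq_qft:
  assumes F [measurable]: "F \<in> borel_measurable borel" and \<Phi> [measurable]: "\<Phi> \<in> borel_measurable borel"
    and eqF: "AE x in lborel. L2_fun f x = F x" and eq\<Phi>: "AE x in lborel. L2_fun \<phi> x = \<Phi> x"
  shows "gqft \<phi> f (\<omega>, b) = qft (\<lambda>x. F x * qcnj (\<Phi> (x - b))) \<omega>"
proof -
  let ?h = "qft_integrand (\<lambda>x. L2_fun f x * qcnj (L2_fun \<phi> (x - b))) \<omega>"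
  let ?H = "qft_integrand (\<lambda>x. F x * qcnj (\<Phi> (x - b))) \<omega>"
  have nth: "(\<lambda>x::real^2. x $ k) \<in> borel_measurable borel" for k
    by (intro borel_measurable_continuous_onI continuous_intros)
  have [measurable]: "(\<lambda>x::real^2. x $ k) \<in> borel_measurable lebesgue" for k
    by (intro measurable_completion) (simp add: nth)
  have [measurable]: "L2_fun f \<in> borel_measurable lebesgue" "L2_fun \<phi> \<in> borel_measurable lebesgue"
    using square_integrable_L2_fun[of f] square_integrable_L2_fun[of \<phi>]
    by (auto simp: square_integrable_def)
  have [measurable]: "(\<lambda>x. L2_fun \<phi> (x - b)) \<in> borel_measurable lebesgue"
    by (rule borel_measurable_lebesgue_translation) fact
  have [measurable]: "(\<lambda>x. F x * qcnj (\<Phi> (x - b))) \<in> borel_measurable borel"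
    by measurable
  have "gqft \<phi> f (\<omega>, b) = (LINT x|lebesgue. ?h x)"
    by (simp add: gqft_def qft_integrand_def mult.assoc)
  also have "\<dots> = (LINT x|lebesgue. ?H x)"
  proof (rule integral_cong_AE)
    show "?h \<in> borel_measurable lebesgue"
      unfolding qft_integrand_def[abs_def] exp_quat_i exp_quat_j by measurable
    show "?H \<in> borel_measurable lebesgue"
      by (intro measurable_completion) simp
    have "AE x in lborel. L2_fun \<phi> (x - b) = \<Phi> (x - b)"
      using AE_lborel_translation[of "\<lambda>x. L2_fun \<phi> x = \<Phi> x" "- b"] eq\<Phi> by simp
    with eqF have "AE x in lborel. ?h x = ?H x"
      by eventually_elim (simp add: qft_integrand_def)
    then show "AE x in lebesgue. ?h x = ?H x"
      by (simp add: AE_completion_iff)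
  qed
  also have "\<dots> = (LINT x|lborel. ?H x)"
    by (intro integral_completion) simp
  finally show ?thesis
    by (simp add: qft_def)
qed

lemma integrable_mult_translate:
  fixes F \<Phi> :: "'a::euclidean_space \<Rightarrow> quat"
  assumes [measurable]: "F \<in> borel_measurable borel" "\<Phi> \<in> borel_measurable borel"
    and intF: "integrable lborel (\<lambda>x. (norm (F x))\<^sup>2)"
    and int\<Phi>: "integrable lborel (\<lambda>x. (norm (\<Phi> x))\<^sup>2)"
  shows "integrable lborel (\<lambda>x. F x * qcnj (\<Phi> (x - b)))"
proof -
  have "integrable (distr lborel borel ((+) (- b))) (\<lambda>x. (norm (\<Phi> x))\<^sup>2)"
    using int\<Phi> by (simp add: lborel_distr_plus)
  then have "integrable lborel (\<lambda>x. (norm (\<Phi> (x - b)))\<^sup>2)"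
    by (subst (asm) integrable_distr_eq) auto
  with intF have "integrable lborel (\<lambda>x. (norm (F x))\<^sup>2 + (norm (\<Phi> (x - b)))\<^sup>2)"
    by (rule Bochner_Integration.integrable_add)
  then show ?thesis
  proof (rule Bochner_Integration.integrable_bound)
    show "AE x in lborel. norm (F x * qcnj (\<Phi> (x - b))) \<le> norm ((norm (F x))\<^sup>2 + (norm (\<Phi> (x - b)))\<^sup>2)"
    proof (rule AE_I2)
      fix x
      have "norm (F x) * norm (\<Phi> (x - b)) \<le> (norm (F x))\<^sup>2 + (norm (\<Phi> (x - b)))\<^sup>2"
        using sum_squares_bound[of "norm (F x)" "norm (\<Phi> (x - b))"]
          mult_nonneg_nonneg[OF norm_ge_zero[of "F x"] norm_ge_zero[of "\<Phi> (x - b)"]]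
        by linarith
      then show "norm (F x * qcnj (\<Phi> (x - b))) \<le> norm ((norm (F x))\<^sup>2 + (norm (\<Phi> (x - b)))\<^sup>2)"
        by (simp add: norm_quat_mult)
    qed
  qed measurable
qed

lemma L2_borel_representative:
  fixes f :: "('a::euclidean_space, 'b::euclidean_space) L2"
  obtains F where "F \<in> borel_measurable borel" "AE x in lborel. L2_fun f x = F x"
    "integrable lborel (\<lambda>x. (norm (F x))\<^sup>2)"
proof -
  have f: "L2_fun f \<in> borel_measurable lebesgue" "integrable lebesgue (\<lambda>x. (norm (L2_fun f x))\<^sup>2)"
    using square_integrable_L2_fun[of f] by (auto simp: square_integrable_def)
  obtain F where F [measurable]: "F \<in> borel_measurable borel" and eq: "AE x in lborel. L2_fun f x = F x"
    using lebesgue_ex_borel_measurable[OF f(1)] by blast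
  have "integrable lebesgue (\<lambda>x. (norm (F x))\<^sup>2)"
  proof (rule integrable_cong_AE_imp[OF f(2)])
    show "(\<lambda>x. (norm (F x))\<^sup>2) \<in> borel_measurable lebesgue"
      by (intro measurable_completion) simp
    have "AE x in lborel. (norm (L2_fun f x))\<^sup>2 = (norm (F x))\<^sup>2"
      using eq by eventually_elim simp
    then show "AE x in lebesgue. (norm (L2_fun f x))\<^sup>2 = (norm (F x))\<^sup>2"
      by (simp add: AE_completion_iff)
  qed
  then have "integrable lborel (\<lambda>x. (norm (F x))\<^sup>2)"
    by (subst (asm) integrable_completion) auto
  with F eq show ?thesis
    by (rule that)
qed

lemma L2_eq_zero_iff: "F = 0 \<longleftrightarrow> (AE x in lebesgue. L2_fun F x = 0)"
proof -
  have "AE x in lebesgue. L2_fun (0 :: ('a::euclidean_space, 'b::euclidean_space) L2) x = 0"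
    unfolding zero_L2_def by (rule L2_fun_L2_class) simp
  then show ?thesis
    unfolding L2_eq_iff by (auto elim: eventually_elim2)
qed

section \<open>From vanishing transforms to a vanishing function\<close>

lemma zero_if_gqft_zero:
  assumes \<phi>: "\<phi> \<noteq> 0" and supp: "ess_supp \<phi> \<subseteq> ball 0 r"
    and S: "\<not> (AE \<omega> in lborel. \<omega> \<in> S)"
    and zero: "AE z in lebesgue. fst z \<notin> S \<longrightarrow> gqft \<phi> f z = 0"
  shows "f = 0"
proof -
  obtain F where F [measurable]: "F \<in> borel_measurable borel" and eqF: "AE x in lborel. L2_fun f x = F x"
    and intF: "integrable lborel (\<lambda>x. (norm (F x))\<^sup>2)"
    by (rule L2_borel_representative)
  obtain \<Phi>0 where \<Phi>0 [measurable]: "\<Phi>0 \<in> borel_measurable borel"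
    and eq\<Phi>0: "AE x in lborel. L2_fun \<phi> x = \<Phi>0 x"
    and int\<Phi>0: "integrable lborel (\<lambda>x. (norm (\<Phi>0 x))\<^sup>2)"
    by (rule L2_borel_representative)
  \<comment> \<open>Cutting to the ball bounds the support of \<open>g b\<close> pointwise, as the
    lemmas on \<open>qft\<close> demand, and not merely up to a null set.\<close>
  define \<Phi> where "\<Phi> x = indicator (ball 0 r) x *\<^sub>R \<Phi>0 x" for x
  have \<Phi> [measurable]: "\<Phi> \<in> borel_measurable borel"
    unfolding \<Phi>_def[abs_def]
    by (intro borel_measurable_scaleR borel_measurable_indicator \<Phi>0) simp
  have int\<Phi>: "integrable lborel (\<lambda>x. (norm (\<Phi> x))\<^sup>2)"
    by (rule Bochner_Integration.integrable_bound[OF int\<Phi>0])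
      (measurable, auto simp: \<Phi>_def indicator_def)
  have "AE x in lborel. x \<notin> ess_supp \<phi> \<longrightarrow> L2_fun \<phi> x = 0"
    using AE_zero_outside_ess_supp[of \<phi>] by (simp add: AE_completion_iff)
  with eq\<Phi>0 have eq\<Phi>: "AE x in lborel. L2_fun \<phi> x = \<Phi> x"
    by eventually_elim (use supp in \<open>auto simp: \<Phi>_def indicator_def\<close>)
  define g where "g b x = F x * qcnj (\<Phi> (x - b))" for b x
  have gqft: "gqft \<phi> f (\<omega>, b) = qft (g b) \<omega>" for \<omega> b
    unfolding g_def[abs_def] by (rule gqft_eq_qft[OF F \<Phi> eqF eq\<Phi>])
  have intg: "integrable lborel (g b)" for b
    unfolding g_def[abs_def] by (rule integrable_mult_translate[OF F \<Phi> intF int\<Phi>])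
  have suppg: "g b x = 0" if "norm b + r < norm x" for b x
  proof -
    have "r < norm (x - b)"
      using that norm_triangle_ineq2[of x b] by linarith
    then show ?thesis
      by (simp add: g_def \<Phi>_def qcnj_altdef)
  qed
  have "AE z in lborel \<Otimes>\<^sub>M lborel. fst z \<notin> S \<longrightarrow> gqft \<phi> f z = 0"
    using zero unfolding lborel_prod AE_completion_iff .
  \<comment> \<open>Fubini is applied to the measurable exceptional set \<open>N\<close>, because
    \<open>S\<close> and the transform are not known to be Borel here.\<close>
  then obtain N where N: "N \<in> null_sets (lborel \<Otimes>\<^sub>M lborel)"
    and zN: "\<And>z. z \<notin> N \<Longrightarrow> fst z \<notin> S \<Longrightarrow> gqft \<phi> f z = 0"
    by (elim AE_E3) (auto simp: space_pair_measure)
  have [measurable]: "N \<in> sets (borel \<Otimes>\<^sub>M borel)"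
    using N by (auto dest!: null_setsD2 cong: sets_pair_measure_cong)
  have "AE \<omega> in lborel. AE b in lborel. (\<omega>, b) \<notin> N"
    by (rule lborel_pair.AE_pair[OF AE_not_in[OF N]])
  then have "AE b in lborel. AE \<omega> in lborel. (\<omega>, b) \<notin> N"
    by (subst lborel_pair.AE_commute[symmetric]) measurable
  then have "AE b in lborel. AE x in lborel. F x = 0 \<or> \<Phi> (x - b) = 0"
  proof eventually_elim
    case (elim b)
    \<comment> \<open>If the zeros formed a null set, almost every frequency would lie in
      \<open>S\<close>, since for almost every \<open>\<omega>\<close> outside \<open>S\<close> the
      transform is zero.\<close>
    have "\<not> (AE \<omega> in lborel. qft (g b) \<omega> \<noteq> 0)"
    proof
      assume "AE \<omega> in lborel. qft (g b) \<omega> \<noteq> 0"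
      with elim have "AE \<omega> in lborel. \<omega> \<in> S"
        by eventually_elim (use zN[of "(_, b)"] in \<open>auto simp: gqft\<close>)
      with S show False
        by simp
    qed
    then have "qft (g b) \<omega> = 0" for \<omega>
      by (rule continuous_zeros_coordinate_lines[OF continuous_on_qft[OF intg], rotated])
        (rule qft_zeros_on_lines[OF intg suppg])
    then have "AE x in lborel. g b x = 0"
      using AE_zero_if_qft_zero[OF intg[of b], of "norm b + r"] suppg by blast
    then show ?case
    proof eventually_elim
      case (elim x)
      then have "norm (g b x) = 0"
        by simp
      then have "norm (F x) * norm (\<Phi> (x - b)) = 0"
        by (simp only: g_def norm_quat_mult norm_qcnj)
      then show ?case
        by simp
    qed
  qed
  \<comment> \<open>The substitution \<open>x = y + b\<close> makes the factor
    \<open>\<Phi> y\<close> independent of \<open>b\<close>, so the quantifiers can be exchanged and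
    one \<open>y\<close> with \<open>\<Phi> y \<noteq> 0\<close> fixed.\<close>
  then have "AE b in lborel. AE y in lborel. F (y + b) = 0 \<or> \<Phi> y = 0"
  proof eventually_elim
    case (elim b)
    then show ?case
      using AE_lborel_translation[of "\<lambda>x. F x = 0 \<or> \<Phi> (x - b) = 0" b] by simp
  qed
  then have "AE y in lborel. AE b in lborel. F (y + b) = 0 \<or> \<Phi> y = 0"
    by (subst lborel_pair.AE_commute[symmetric]) measurable
  moreover have "\<not> (AE y in lborel. \<Phi> y = 0)"
  proof
    assume "AE y in lborel. \<Phi> y = 0"
    with eq\<Phi> have "AE x in lborel. L2_fun \<phi> x = 0"
      by eventually_elim simp
    with \<phi> show False
      by (simp add: L2_eq_zero_iff AE_completion_iff)
  qed
  ultimately obtain y where y: "\<Phi> y \<noteq> 0" "AE b in lborel. F (y + b) = 0 \<or> \<Phi> y = 0"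
    by (metis (mono_tags, lifting) AE_mp AE_I2)
  then have "AE b in lborel. F b = 0"
    using AE_lborel_translation[of "\<lambda>x. F x = 0" y] by (simp add: add.commute[of y])
  with eqF have "AE x in lborel. L2_fun f x = 0"
    by eventually_elim simp
  then show ?thesis
    by (simp add: L2_eq_zero_iff AE_completion_iff)
qed

text \<open>If \<open>S\<close> were conull, \<open>S \<times> T\<close> would contain
  \<open>UNIV \<times> T\<close> up to a null set, and the latter has infinite measure because
  \<open>T\<close> has positive measure.\<close>

lemma nonnull_complement_if_finite_Times:
  fixes S :: "'a::euclidean_space set" and T :: "'b::euclidean_space set"
  assumes ST: "S \<times> T \<in> sets lebesgue" "emeasure lebesgue (S \<times> T) < \<infinity>"
    and T [measurable]: "T \<in> sets borel" and pos: "0 < emeasure lborel T"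
  shows "\<not> (AE \<omega> in lborel. \<omega> \<in> S)"
proof
  assume "AE \<omega> in lborel. \<omega> \<in> S"
  then obtain N where N: "N \<in> null_sets lborel" "\<And>\<omega>. \<omega> \<notin> N \<Longrightarrow> \<omega> \<in> S"
    by (elim AE_E3) auto
  have "N \<times> (UNIV :: 'b set) \<in> null_sets (lborel \<Otimes>\<^sub>M lborel)"
    using null_setsD1[OF N(1)] null_setsD2[OF N(1)]
    by (intro null_setsI) (auto simp: lborel.emeasure_pair_measure_Times)
  then have "AE z in lborel. z \<notin> N \<times> (UNIV :: 'b set)"
    by (simp add: lborel_prod AE_not_in)
  then have "AE z in lebesgue. z \<in> (UNIV :: 'a set) \<times> T \<longrightarrow> z \<in> S \<times> T"
    unfolding AE_completion_iff by eventually_elim (use N(2) in auto)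
  then have "emeasure lebesgue ((UNIV :: 'a set) \<times> T) \<le> emeasure lebesgue (S \<times> T)"
    by (rule emeasure_mono_AE) fact
  moreover have "emeasure lebesgue ((UNIV :: 'a set) \<times> T) = \<infinity>"
  proof -
    have "(UNIV :: 'a set) \<times> T \<in> sets (lborel \<Otimes>\<^sub>M lborel)"
      by (intro pair_measureI) auto
    then have "(UNIV :: 'a set) \<times> T \<in> sets lborel"
      by (simp only: lborel_prod)
    then have "emeasure lebesgue ((UNIV :: 'a set) \<times> T) = emeasure (lborel \<Otimes>\<^sub>M lborel) ((UNIV :: 'a set) \<times> T)"
      by (simp add: lborel_prod main_part_sets)
    also have "\<dots> = emeasure lborel (UNIV :: 'a set) * emeasure lborel T"
      by (rule lborel.emeasure_pair_measure_Times) auto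
    also have "\<dots> = \<infinity>"
      using pos by (simp add: emeasure_lborel_UNIV ennreal_top_mult)
    finally show ?thesis .
  qed
  ultimately show False
    using ST(2) by simp
qed

section \<open>Projections and the intersection of their ranges\<close>

lemma gqft_zero [simp]: "gqft \<phi> 0 z = 0"
proof -
  have "AE x in lebesgue. L2_fun (0 :: (real^2, quat) L2) x = 0"
    using L2_eq_zero_iff by blast
  then have "AE x in lebesgue. exp ((- 2 * pi * (x $ 1) * (\<omega> $ 1)) *\<^sub>R quat_i) * L2_fun 0 x * qcnj (L2_fun \<phi> (x - b))
        * exp ((- 2 * pi * (x $ 2) * (\<omega> $ 2)) *\<^sub>R quat_j) = 0" for \<omega> b :: "real^2"
    by eventually_elim simp
  then have "gqft \<phi> 0 (\<omega>, b) = 0" for \<omega> b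
    unfolding gqft_def by (simp add: integral_eq_zero_AE)
  then show ?thesis
    by (cases z) auto
qed

text \<open>If \<open>y \<in> V\<close> and \<open>0 - y \<in> V\<^sup>\<bottom>\<close>, then
  \<open>y\<close> is orthogonal to itself, which leaves 0 as the unique candidate.\<close>

lemma orth_projection_zero: "0 \<in> V \<Longrightarrow> orth_projection V 0 = 0"
  by (auto simp: orth_projection_def orthogonal_comp_def orthogonal_def intro!: the1_equality)

text \<open>The second alternative covers the default value 0 in the definition of the
  projection.\<close>

lemma orth_projection_in: "orth_projection V x \<in> V \<or> orth_projection V x = 0"
  unfolding orth_projection_def using theI'[of "\<lambda>y. y \<in> V \<and> x - y \<in> V\<^sup>\<bottom>"] by auto

theorem theorem4p8:
  fixes r R :: real
    and \<phi> :: "(real^2, quat) L2"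
    and S :: "(real^2) set"
    and \<Sigma> :: "((real^2) \<times> (real^2)) set"
  assumes "r > 0" and "R > 0"
    and "\<phi> \<noteq> 0" and "essentially_bounded \<phi>" and "ess_supp \<phi> \<subseteq> ball 0 r"
    and "S \<in> sets lebesgue" and "\<Sigma> = S \<times> ball 0 R"
    and "0 < emeasure lebesgue \<Sigma>" and "emeasure lebesgue \<Sigma> < \<infinity>"
  shows "range (P_window \<phi>) \<inter> range (P_set \<Sigma>) = {0} \<and> weakly_annihilating \<phi> \<Sigma>"
proof -
  \<comment> \<open>A non-measurable set has \<open>emeasure\<close> 0 by convention, so positive
    measure gives measurability.\<close>
  have \<Sigma>: "\<Sigma> \<in> sets lebesgue"
    using \<open>0 < emeasure lebesgue \<Sigma>\<close> emeasure_notin_sets by fastforce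
  have "0 < emeasure lborel (ball (0 :: real^2) R)"
    using \<open>R > 0\<close> by (simp add: emeasure_ball)
  then have S: "\<not> (AE \<omega> in lborel. \<omega> \<in> S)"
    using \<Sigma> \<open>emeasure lebesgue \<Sigma> < \<infinity>\<close> unfolding \<open>\<Sigma> = S \<times> ball 0 R\<close>
    by (intro nonnull_complement_if_finite_Times[where T = "ball 0 R"]) auto
  have ann: "f = 0" if "AE z in lebesgue. z \<notin> \<Sigma> \<longrightarrow> gqft \<phi> f z = 0" for f
  proof (rule zero_if_gqft_zero[OF \<open>\<phi> \<noteq> 0\<close> \<open>ess_supp \<phi> \<subseteq> ball 0 r\<close> S])
    show "AE z in lebesgue. fst z \<notin> S \<longrightarrow> gqft \<phi> f z = 0"
      using that by eventually_elim (auto simp: \<open>\<Sigma> = S \<times> ball 0 R\<close>)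
  qed
  have "0 \<in> gqft_range \<phi>"
    using L2_eq_zero_iff[of "0 :: ((real^2) \<times> (real^2), quat) L2"]
    by (auto simp: gqft_range_def intro!: exI[of _ 0])
  then have "P_window \<phi> 0 = 0"
    by (simp add: P_window_def orth_projection_zero)
  moreover have "P_set \<Sigma> 0 = (0 :: ((real^2) \<times> (real^2), quat) L2)"
  proof -
    have "AE z in lebesgue. L2_fun (0 :: ((real^2) \<times> (real^2), quat) L2) z = 0"
      using L2_eq_zero_iff by blast
    with L2_fun_P_set[OF \<Sigma>, of "0 :: ((real^2) \<times> (real^2), quat) L2"]
    have "AE z in lebesgue. L2_fun (P_set \<Sigma> (0 :: ((real^2) \<times> (real^2), quat) L2)) z = 0"
      by eventually_elim simp
    then show ?thesis
      by (simp add: L2_eq_zero_iff)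
  qed
  moreover have "G = 0" if G: "G \<in> range (P_window \<phi>)" "G \<in> range (P_set \<Sigma>)" for G
  proof (rule ccontr)
    assume "G \<noteq> 0"
    \<comment> \<open>A nonzero \<open>G\<close> cannot be the default value of the projection, so
      it is a transform.\<close>
    then have "G \<in> gqft_range \<phi>"
      using G(1) orth_projection_in[of "gqft_range \<phi>"] unfolding P_window_def by blast
    then obtain f where f: "AE z in lebesgue. L2_fun G z = gqft \<phi> f z"
      by (auto simp: gqft_range_def)
    obtain H where "G = P_set \<Sigma> H"
      using G(2) by blast
    then have "AE z in lebesgue. L2_fun G z = indicator \<Sigma> z *\<^sub>R L2_fun H z"
      using L2_fun_P_set[OF \<Sigma>] by blast
    with f have "AE z in lebesgue. z \<notin> \<Sigma> \<longrightarrow> gqft \<phi> f z = 0"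
      by eventually_elim auto
    then have "f = 0"
      by (rule ann)
    with f \<open>G \<noteq> 0\<close> show False
      by (simp add: L2_eq_zero_iff)
  qed
  ultimately have "range (P_window \<phi>) \<inter> range (P_set \<Sigma>) = {0}"
    by (auto intro: rev_image_eqI)
  with \<Sigma> ann show ?thesis
    by (auto simp: weakly_annihilating_def)
qed

end
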